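(* There exist constants $C>0$, $c>0$ and $\lambda_0>0$ such that for all $\lambda>\lambda_0$, all $E\in[-2\lambda,2\lambda]$, every $\beta\in\mathbb{R}$ and all integers $n>C\log\lambda$, $$\mathrm{mes}\Big\{x\in\mathbb{T}:\Big|\frac1n\log\|\boldsymbol{v}_n(x)\|-\log\lambda\Big|>A_f\Big\}<e^{-\frac{cn}{\log\lambda}},$$ where $A_f=1+\max\big\{10\log(3C_f),\ \tfrac12\log10+\tfrac14C_f\lambda^{-1}\big\}$.
   Context: $\mathbb{T}=\mathbb{R}/\mathbb{Z}$ with Lebesgue measure $\mathrm{mes}$; $Tx=2x\bmod1$ is the doubling map. The function $f:\mathbb{T}\to\mathbb{R}$ is monotonic (on $[0,1)$), $C^1$ on $(0,1)$ with finite $C^1(0,1)$ norm, with a jump discontinuity on the torus at $0$, $f(0)=\lim_{x\to0^+}f(x)$, finite right derivative at $0$, and $\inf_{(0,1)}|f'|>0$; it is normalized so that $f(0)=0$, $\lim_{x\to1^-}f(x)=1$, $f'_+(0)=1$ and $f'(x)\in(c_0,1]$ on $(0,1)$ for some constant $c_0>0$. For $\lambda>0$ and $E\in[-2\lambda,2\lambda]$ put $g(x)=(E/\lambda-f(x))^2+1$ and let $\theta(x)\in(0,\pi)$ be defined by $\cot\theta(x)=E/\lambda-f(x)$. Let $R_\theta=\begin{pmatrix}\cos\theta&-\sin\theta\\ \sin\theta&\cos\theta\end{pmatrix}$, $\Lambda(x)=\mathrm{diag}\big(\lambda\sqrt{g(x)},(\lambda\sqrt{g(x)})^{-1}\big)$,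 $B(x)=B(x,E)=\Lambda(Tx)R_{\theta(x)}$, and $B_n(x)=B(T^{n-1}x)\cdots B(Tx)B(x)$, $B_0=I$. For a unit initial vector $w=(\cos\beta,\sin\beta)^T$ put $\boldsymbol{v}_n(x)=B_n(x)w$, and let $\theta_k(x)$ ($k\ge0$) be the argument of the vector $R_{\theta(T^kx)}B_k(x)w$ (so $\theta_0(x)=\theta(x)+\beta$). $C_f>0$ is a fixed constant, depending only on $f$, such that for all sufficiently large $\lambda$, all $E\in[-2\lambda,2\lambda]$, all $n\ge0$ and $\delta>0$, $\mathrm{mes}\{x\in\mathbb{T}:\|\theta_n(x)-\tfrac{\pi}{2}\|_{\mathbb{R}\mathbb{P}^1}<\delta\}<C_f\delta$, where $\|\cdot\|_{\mathbb{R}\mathbb{P}^1}$ is the distance to the nearest point of $\pi\mathbb{Z}$. *)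

theory Defs
  imports "HOL-Analysis.Analysis"
begin

text \<open>
  The torus \<open>\<real>/\<int>\<close> is represented by its fundamental domain \<open>{0..<1}\<close>; a function on the torus is a
  function on the reals whose values outside \<open>{0..<1}\<close> play no role.
\<close>

definition doubling :: "real \<Rightarrow> real" where
  "doubling x = frac (2 * x)"

definition mes_torus :: "(real \<Rightarrow> bool) \<Rightarrow> real" where
  "mes_torus P = measure lebesgue {x \<in> {0..<1}. P x}"

text \<open>
  The left limit of \<open>f\<close> at \<open>1\<close> is the left limit at the point \<open>0\<close> of the torus, so
  \<open>l \<noteq> f 0\<close> expresses the jump of \<open>f\<close> at \<open>0\<close>.
\<close>

definition monotone_with_jump :: "(real \<Rightarrow> real) \<Rightarrow> bool" where
  "monotone_with_jump f \<longleftrightarrow>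
     (mono_on {0..<1} f \<or> antimono_on {0..<1} f) \<and>
     f differentiable_on {0<..<1} \<and> continuous_on {0<..<1} (deriv f) \<and>
     (bounded (f ` {0<..<1}) \<and> bounded (deriv f ` {0<..<1})) \<and>
     (\<exists>l. (f \<longlongrightarrow> l) (at_left 1) \<and> l \<noteq> f 0) \<and>
     (f \<longlongrightarrow> f 0) (at_right 0) \<and>
     (\<exists>D. (f has_real_derivative D) (at_right 0)) \<and>
     (INF x\<in>{0<..<1}. \<bar>deriv f x\<bar>) > 0"

definition normalized :: "(real \<Rightarrow> real) \<Rightarrow> bool" where
  "normalized f \<longleftrightarrow>
     f 0 = 0 \<and> (f \<longlongrightarrow> 1) (at_left 1) \<and> (f has_real_derivative 1) (at_right 0) \<and>
     (\<exists>c0>0. \<forall>x\<in>{0<..<1}. deriv f x \<in> {c0<..1})"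

definition gfun :: "(real \<Rightarrow> real) \<Rightarrow> real \<Rightarrow> real \<Rightarrow> real \<Rightarrow> real" where
  "gfun f lam E x = (E / lam - f x)\<^sup>2 + 1"

definition theta :: "(real \<Rightarrow> real) \<Rightarrow> real \<Rightarrow> real \<Rightarrow> real \<Rightarrow> real" where
  "theta f lam E x = (THE t. 0 < t \<and> t < pi \<and> cot t = E / lam - f x)"

lemma ex1_cot: "\<exists>!t. 0 < t \<and> t < pi \<and> cot t = (y::real)"
proof (rule ex1I[of _ "pi / 2 - arctan y"])
  have "cot (pi / 2 - arctan y) = tan (arctan y)"
    by (simp add: cot_def tan_def sin_diff cos_diff)
  then show "0 < pi / 2 - arctan y \<and> pi / 2 - arctan y < pi \<and> cot (pi / 2 - arctan y) = y"
    using arctan_bounded[of y] by (auto simp: tan_arctan)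
next
  fix t assume t: "0 < t \<and> t < pi \<and> cot t = y"
  have "tan (pi / 2 - t) = cot t"
    by (simp add: cot_def tan_def sin_diff cos_diff)
  then have "arctan y = pi / 2 - t"
    using t by (intro arctan_unique) auto
  then show "t = pi / 2 - arctan y" by simp
qed

definition rot :: "real \<Rightarrow> real^2^2" where
  "rot t = vector [vector [cos t, - sin t], vector [sin t, cos t]]"

definition Lam :: "(real \<Rightarrow> real) \<Rightarrow> real \<Rightarrow> real \<Rightarrow> real \<Rightarrow> real^2^2" where
  "Lam f lam E x =
     vector [vector [lam * sqrt (gfun f lam E x), 0],
             vector [0, inverse (lam * sqrt (gfun f lam E x))]]"

definition Bmat :: "(real \<Rightarrow> real) \<Rightarrow> real \<Rightarrow> real \<Rightarrow> real \<Rightarrow> real^2^2" where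
  "Bmat f lam E x = Lam f lam E (doubling x) ** rot (theta f lam E x)"

fun Biter :: "(real \<Rightarrow> real) \<Rightarrow> real \<Rightarrow> real \<Rightarrow> nat \<Rightarrow> real \<Rightarrow> real^2^2" where
  "Biter f lam E 0 x = mat 1"
| "Biter f lam E (Suc n) x = Bmat f lam E ((doubling ^^ n) x) ** Biter f lam E n x"

definition unit_vec :: "real \<Rightarrow> real^2" where
  "unit_vec \<beta> = vector [cos \<beta>, sin \<beta>]"

definition vvec :: "(real \<Rightarrow> real) \<Rightarrow> real \<Rightarrow> real \<Rightarrow> real \<Rightarrow> nat \<Rightarrow> real \<Rightarrow> real^2" where
  "vvec f lam E \<beta> n x = Biter f lam E n x *v unit_vec \<beta>"

text \<open>
  Arguments are normalized to \<open>(-pi, pi]\<close>, so \<open>theta_iter f lam E \<beta> 0 x\<close> equals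
  \<open>theta f lam E x + \<beta>\<close> only modulo \<open>2 * pi\<close>; it is used only through \<open>rp1_norm\<close>, which
  has period \<open>pi\<close>.
\<close>

definition vec_arg :: "real^2 \<Rightarrow> real" where
  "vec_arg v = Arg (Complex (v $ 1) (v $ 2))"

definition theta_iter :: "(real \<Rightarrow> real) \<Rightarrow> real \<Rightarrow> real \<Rightarrow> real \<Rightarrow> nat \<Rightarrow> real \<Rightarrow> real" where
  "theta_iter f lam E \<beta> k x =
     vec_arg (rot (theta f lam E ((doubling ^^ k) x)) *v vvec f lam E \<beta> k x)"

definition rp1_norm :: "real \<Rightarrow> real" where
  "rp1_norm t = infdist t (range (\<lambda>k::int. pi * of_int k))"

definition angle_constant :: "(real \<Rightarrow> real) \<Rightarrow> real \<Rightarrow> bool" where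
  "angle_constant f Cf \<longleftrightarrow>
     Cf > 0 \<and>
     (\<forall>\<^sub>F lam in at_top. \<forall>E\<in>{- 2 * lam..2 * lam}. \<forall>\<beta> n. \<forall>\<delta>>0.
        mes_torus (\<lambda>x. rp1_norm (theta_iter f lam E \<beta> n x - pi / 2) < \<delta>) < Cf * \<delta>)"

definition A_const :: "real \<Rightarrow> real \<Rightarrow> real" where
  "A_const Cf lam = 1 + max (10 * ln (3 * Cf)) (1 / 2 * ln 10 + 1 / 4 * Cf * inverse lam)"

end

theory Submission
  imports Defs
begin

text \<open>
  Write \<open>v_k\<close> for the vector after \<open>k\<close> steps. One step multiplies the norm by
  \<open>\<lambda> * sqrt (g cos\<^sup>2 \<theta>_k + sin\<^sup>2 \<theta>_k / (\<lambda>^4 g))\<close> with \<open>1 \<le> g \<le> 10\<close>. Growth faster than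
  \<open>\<lambda> * sqrt 10\<close> per step is therefore impossible, and the whole problem is to bound the total loss, which is about
  the sum over \<open>k < n\<close> of \<open>- ln \<bar>cos \<theta>_k\<bar>\<close>, each term being cut off at a multiple of \<open>ln \<lambda>\<close>.

  The one-time distribution of \<open>\<theta>_k\<close> is not enough for this; what is needed is its distribution conditioned on the
  past, that is, on a dyadic interval of \<open>x\<close>. The normalization forces \<open>f x = x\<close>, and then
  \<open>r_k = cot \<theta>_k\<close> is decreasing in \<open>x\<close> with slope at least \<open>2 ^ k / 10\<close> between its poles, on every interval of
  continuity of \<open>T^k\<close> (\<open>Wronskian_bound\<close>, \<open>ratio_decreasing\<close>). So the proportion of points of a dyadic interval
  with \<open>\<bar>r_k\<bar> < \<eta>\<close> is at most a multiple of \<open>\<eta>\<close> times the average number of poles per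
  branch of \<open>T^k\<close> in that interval. Poles are controlled by
  interlacing: on a fixed interval each step creates at most one (\<open>den_zeros_interlace\<close>), while each further
  level doubles the number of branches. After a gap of \<open>g\<close> levels, \<open>N\<close> initial poles contribute only
  \<open>N / 2 ^ g\<close> to the average (\<open>sum_card_zeros_le\<close>).

  Let \<open>L\<close> be of order \<open>ln \<lambda>\<close>, so that \<open>2 ^ -L\<close> resolves angles of size \<open>\<lambda>^-2\<close>, and call depth of time \<open>k\<close>
  the truncated value of \<open>log\<^sub>2 (1 / \<bar>r_k\<bar>)\<close>. Along times in one residue class modulo \<open>2 L\<close>
  the depths are nearly independent: each further time multiplies the moment with base \<open>3 / 2\<close>,
  weighted by \<open>1 + N / 2 ^ L\<close> to keep track of the poles, by at most \<open>135\<close>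
  (\<open>weighted_moment_step\<close>, \<open>class_moment\<close>). Convexity of the exponential combines the \<open>2 L\<close> classes
  (\<open>total_depth_moment\<close>), and Markov's inequality shows that the mean depth exceeds \<open>20\<close> with probability at most
  \<open>270 * exp (- n / L)\<close>.

  A mean depth of at most \<open>20\<close> costs less than \<open>21\<close> in the exponent (\<open>ln_norm_vvec_lower\<close>). This is within the
  allowed deviation, because the constant of the angle estimate cannot be small: already \<open>\<theta>_0\<close> at the energy
  \<open>- 2 \<lambda>\<close> shows \<open>Cf > 5\<close> (\<open>angle_constant_gt_5\<close>).
\<close>

section \<open>Branches of the iterated doubling map\<close>

text \<open>
  The cell \<open>dcell l i\<close> is a branch of the \<open>l\<close>-th iterate of the doubling map: the first \<open>l\<close> iterates
  are affine on it, so functions of \<open>x, T x, \<dots>, T^l x\<close> can be differentiated there.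
\<close>

definition dcell :: "nat \<Rightarrow> nat \<Rightarrow> real set" where
  "dcell l i = {real i / 2 ^ l ..< (real i + 1) / 2 ^ l}"

lemma mem_dcell: "x \<in> dcell l i \<longleftrightarrow> real i \<le> 2 ^ l * x \<and> 2 ^ l * x < real i + 1"
  by (auto simp: dcell_def field_simps)

lemma floor_dcell: "x \<in> dcell l i \<Longrightarrow> \<lfloor>2 ^ l * x\<rfloor> = int i"
  by (auto simp: mem_dcell floor_eq_iff)

lemma dcell_coarsen:
  assumes "x \<in> dcell (l + d) i"
  shows "x \<in> dcell l (i div 2 ^ d)"
proof -
  have i: "real i \<le> 2 ^ d * (2 ^ l * x)" "2 ^ d * (2 ^ l * x) < real i + 1"
    using assms by (auto simp: mem_dcell power_add algebra_simps)
  have "real (i div 2 ^ d * 2 ^ d) \<le> real i"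
    by (intro of_nat_mono) (simp add: div_times_less_eq_dividend)
  then have "2 ^ d * real (i div 2 ^ d) \<le> real i"
    by (simp add: mult.commute)
  then have "2 ^ d * real (i div 2 ^ d) \<le> 2 ^ d * (2 ^ l * x)"
    using i(1) by (rule order_trans)
  moreover have "i + 1 \<le> (i div 2 ^ d + 1) * 2 ^ d"
    using dividend_less_div_times[of "2 ^ d" i] by simp
  then have "real (i + 1) \<le> real ((i div 2 ^ d + 1) * 2 ^ d)"
    by (rule of_nat_mono)
  then have "2 ^ d * (2 ^ l * x) < 2 ^ d * (real (i div 2 ^ d) + 1)"
    using i by (simp add: algebra_simps)
  ultimately show ?thesis
    by (simp only: mem_dcell mult_le_cancel_left_pos mult_less_cancel_left_pos
        zero_less_power zero_less_numeral)
qed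

lemma dcell_split:
  "dcell l i = (\<Union>j<2 ^ d. dcell (l + d) (i * 2 ^ d + j))"
proof (intro equalityI subsetI)
  fix x assume "x \<in> dcell l i"
  then have x: "real i \<le> 2 ^ l * x" "2 ^ l * x < real i + 1" by (auto simp: mem_dcell)
  define m where "m = nat \<lfloor>2 ^ (l + d) * x\<rfloor>"
  have "0 \<le> x"
    using x by (smt (verit) of_nat_0_le_iff zero_le_mult_iff zero_less_power)
  then have m: "real m \<le> 2 ^ (l + d) * x" "2 ^ (l + d) * x < real m + 1"
    unfolding m_def by (auto simp: of_nat_nat)
  have "real (i * 2 ^ d) \<le> 2 ^ (l + d) * x"
    using x(1) by (simp add: power_add algebra_simps)
  then have lo: "i * 2 ^ d \<le> m"
    using m by linarith
  have "2 ^ d * (2 ^ l * x) < 2 ^ d * (real i + 1)"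
    using x(2) by (intro mult_strict_left_mono) auto
  then have "2 ^ (l + d) * x < real ((i + 1) * 2 ^ d)"
    by (simp add: power_add algebra_simps)
  then have hi: "m < (i + 1) * 2 ^ d"
    using m by linarith
  show "x \<in> (\<Union>j<2 ^ d. dcell (l + d) (i * 2 ^ d + j))"
    using m lo hi by (intro UN_I[of "m - i * 2 ^ d"]) (auto simp: mem_dcell)
next
  fix x assume "x \<in> (\<Union>j<2 ^ d. dcell (l + d) (i * 2 ^ d + j))"
  then obtain j where j: "j < 2 ^ d" "x \<in> dcell (l + d) (i * 2 ^ d + j)" by auto
  then show "x \<in> dcell l i"
    using dcell_coarsen[OF j(2)] by simp
qed

lemma dcell_unique: "x \<in> dcell l i \<Longrightarrow> x \<in> dcell l j \<Longrightarrow> i = j"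
  by (auto dest!: floor_dcell)

lemma dcell_interval: "u \<in> dcell l i \<Longrightarrow> v \<in> dcell l i \<Longrightarrow> {u..v} \<subseteq> dcell l i"
  by (auto simp: dcell_def)

lemma iterated_doubling:
  assumes "x \<in> {0..<1}"
  shows "(doubling ^^ k) x = frac (2 ^ k * x)"
proof (induction k)
  case 0
  then show ?case using assms by (simp add: frac_eq)
next
  case (Suc k)
  have "2 * frac (2 ^ k * x) = 2 ^ Suc k * x - of_int (2 * \<lfloor>2 ^ k * x\<rfloor>)"
    by (simp add: frac_def algebra_simps)
  then have "frac (2 * frac (2 ^ k * x)) = frac (2 ^ Suc k * x)"
    by (simp only: frac_def floor_diff_of_int of_int_diff)
  then show ?case using Suc by (simp add: doubling_def)
qed

lemma frac_on_dcell:
  assumes "k \<le> l" "x \<in> dcell l i"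
  shows "frac (2 ^ k * x) = 2 ^ k * x - real (i div 2 ^ (l - k))"
  using floor_dcell[of x k "i div 2 ^ (l - k)"] dcell_coarsen[of x k "l - k" i] assms
  by (simp add: frac_def)

text \<open>
  One-sided derivatives at the left end of a cell are included, so that the mean value theorem
  applies to every closed interval inside a half-open cell.
\<close>

lemma frac_on_dcell_deriv:
  assumes "k \<le> l" "x \<in> dcell l i"
  shows "((\<lambda>x. frac (2 ^ k * x)) has_real_derivative 2 ^ k) (at x within dcell l i)"
proof -
  have "((\<lambda>x. 2 ^ k * x - real (i div 2 ^ (l - k))) has_real_derivative 2 ^ k)
          (at x within dcell l i)"
    by (auto intro!: derivative_eq_intros)
  then show ?thesis
    by (rule has_field_derivative_transform_within[of _ _ _ _ 1])
       (use assms frac_on_dcell in auto)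
qed

section \<open>The normalized potential is the identity\<close>

text \<open>
  The normalization is rigid: \<open>f' \<le> 1\<close> while \<open>f\<close> climbs from \<open>0\<close> to \<open>1\<close> over an interval of length
  \<open>1\<close>, so the mean value theorem on both sides of \<open>x\<close> leaves \<open>f x = x\<close> as the only possibility.
\<close>

lemma normalized_is_identity:
  assumes mj: "monotone_with_jump f" and nf: "normalized f" and x: "x \<in> {0..<1}"
  shows "f x = x"
proof (cases "x = 0")
  case True
  then show ?thesis using nf by (simp add: normalized_def)
next
  case False
  with x have x: "0 < x" "x < 1" by auto
  have diff: "(f has_real_derivative deriv f y) (at y)" if "0 < y" "y < 1" for y
    using mj that unfolding monotone_with_jump_def
    by (metis DERIV_deriv_iff_real_differentiable at_within_open differentiable_on_def
        greaterThanLessThan_iff open_greaterThanLessThan)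
  have d1: "deriv f y \<le> 1" if "0 < y" "y < 1" for y
    using nf that by (auto simp: normalized_def)
  have lip: "f v - f u \<le> v - u" if uv: "0 < u" "u < v" "v < 1" for u v
  proof -
    have "\<exists>z. u < z \<and> z < v \<and> f v - f u = (v - u) * deriv f z"
      using uv by (intro MVT2) (auto intro!: diff)
    then obtain z where z: "u < z" "z < v" "f v - f u = (v - u) * deriv f z" by blast
    have "(v - u) * deriv f z \<le> (v - u) * 1"
      using d1[of z] z uv by (intro mult_left_mono) auto
    then show ?thesis using z by simp
  qed
  have r0: "(f \<longlongrightarrow> 0) (at_right 0)" and l1: "(f \<longlongrightarrow> 1) (at_left 1)"
    using mj nf by (auto simp: monotone_with_jump_def normalized_def)
  have "((\<lambda>u. f u + (x - u)) \<longlongrightarrow> 0 + (x - 0)) (at_right 0)"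
    by (intro tendsto_intros r0)
  moreover have "\<forall>\<^sub>F u in at_right 0. f x \<le> f u + (x - u)"
    unfolding eventually_at_right_field using x lip[of _ x] by (intro exI[of _ x]) force
  ultimately have le: "f x \<le> 0 + (x - 0)"
    by (rule tendsto_lowerbound) simp
  have "((\<lambda>v. f v - (v - x)) \<longlongrightarrow> 1 - (1 - x)) (at_left 1)"
    by (intro tendsto_intros l1)
  moreover have "\<forall>\<^sub>F v in at_left 1. f v - (v - x) \<le> f x"
    unfolding eventually_at_left_field using x lip[of x] by (intro exI[of _ x]) force
  ultimately have "1 - (1 - x) \<le> f x"
    by (rule tendsto_upperbound) simp
  with le show ?thesis by simp
qed

section \<open>The cotangent of the angle decreases between its poles\<close>

lemma card_le_Suc_if_interlaced:
  fixes S T :: "real set"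
  assumes "finite S" and "\<And>t t'. t \<in> T \<Longrightarrow> t' \<in> T \<Longrightarrow> t < t' \<Longrightarrow> \<exists>s\<in>S. t < s \<and> s < t'"
  shows "finite T \<and> card T \<le> Suc (card S)"
proof -
  let ?h = "\<lambda>t. card {s \<in> S. s < t}"
  have mono: "?h t < ?h t'" if t: "t \<in> T" "t' \<in> T" "t < t'" for t t'
  proof -
    obtain s where "s \<in> S" "t < s" "s < t'" using assms(2)[OF t] by blast
    then have "s \<in> {s \<in> S. s < t'} - {s \<in> S. s < t}" by simp
    moreover have "{s \<in> S. s < t} \<subseteq> {s \<in> S. s < t'}" using t(3) by auto
    ultimately have "{s \<in> S. s < t} \<subset> {s \<in> S. s < t'}" by blast
    then show ?thesis using assms(1) by (intro psubset_card_mono) auto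
  qed
  have inj: "inj_on ?h T"
    by (rule strict_mono_on_imp_inj_on) (rule strict_mono_onI, rule mono)
  have sub: "?h ` T \<subseteq> {..card S}"
    using assms(1) by (auto intro!: card_mono)
  have "finite T" using inj sub finite_subset[OF sub] by (auto dest: finite_imageD)
  moreover have "card T \<le> card {..card S}"
    using inj sub by (intro card_inj_on_le) auto
  ultimately show ?thesis by simp
qed

text \<open>
  Here \<open>e = E / \<lambda>\<close>. The bound on \<open>\<lambda>\<close> is what makes the Wronskian estimate below close.
\<close>

locale doubling_cocycle =
  fixes e lam beta :: real
  assumes e: "\<bar>e\<bar> \<le> 2" and lam: "lam \<ge> 5"
begin

text \<open>
  For the potential \<open>f x = x\<close> this is the cotangent of \<open>\<theta>(T^k x)\<close>, and \<open>g_orbit k x\<close> is \<open>g(T^k x)\<close>.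
\<close>

definition cot_theta :: "nat \<Rightarrow> real \<Rightarrow> real" where
  "cot_theta k x = e - frac (2 ^ k * x)"

definition g_orbit :: "nat \<Rightarrow> real \<Rightarrow> real" where
  "g_orbit k x = (cot_theta k x)\<^sup>2 + 1"

text \<open>
  Up to the common factor \<open>1 / sqrt (g(x))\<close> these are the two coordinates of \<open>R_\<theta>(T^k x) B_k(x) w\<close>, so
  that \<open>num k x / den k x\<close> is the cotangent of the angle \<open>\<theta>_k(x)\<close>. The recursion is multiplication by
  \<open>R_\<theta> \<Lambda>\<close>, in which the square roots of \<open>g\<close> cancel; the factor is removed so that all entries are rational
  in \<open>x\<close>.
\<close>

fun num den :: "nat \<Rightarrow> real \<Rightarrow> real" where
  "num 0 x = cot_theta 0 x * cos beta - sin beta"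
| "den 0 x = cos beta + cot_theta 0 x * sin beta"
| "num (Suc k) x = lam * cot_theta (Suc k) x * num k x - den k x / (lam * g_orbit (Suc k) x)"
| "den (Suc k) x = lam * num k x + cot_theta (Suc k) x * den k x / (lam * g_orbit (Suc k) x)"

lemma cot_theta_bound: "\<bar>cot_theta k x\<bar> \<le> 3"
  using e frac_ge_0[of "2 ^ k * x"] frac_lt_1[of "2 ^ k * x"] unfolding cot_theta_def by linarith

lemma g_orbit_bounds: "1 \<le> g_orbit k x" "g_orbit k x \<le> 10"
  using abs_le_square_iff[of "cot_theta k x" 3] cot_theta_bound[of k x] by (auto simp: g_orbit_def)

lemma lam_pos: "lam > 0" using lam by simp

lemma lam_sq: "lam\<^sup>2 \<ge> 25"
  using power_mono[of 5 lam 2] lam by simp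

lemma initial_norm: "(num 0 x)\<^sup>2 + (den 0 x)\<^sup>2 = g_orbit 0 x"
proof -
  have "(num 0 x)\<^sup>2 + (den 0 x)\<^sup>2 = g_orbit 0 x * ((cos beta)\<^sup>2 + (sin beta)\<^sup>2)"
    unfolding num.simps den.simps g_orbit_def by algebra
  then show ?thesis by simp
qed

text \<open>
  Both coordinates can be recovered from the next two, since the transfer matrix has determinant \<open>1\<close>.
\<close>

lemma num_den_nonzero: "num k x \<noteq> 0 \<or> den k x \<noteq> 0"
proof (induction k)
  case 0
  show ?case using initial_norm[of x] g_orbit_bounds(1)[of 0 x] by (auto simp del: num.simps den.simps)
next
  case (Suc k)
  let ?a = "cot_theta (Suc k) x" and ?g = "g_orbit (Suc k) x"
  have g: "?g > 0" using g_orbit_bounds(1)[of "Suc k" x] by simp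
  have gg: "1 + ?a\<^sup>2 = ?g" by (simp add: g_orbit_def)
  have "num (Suc k) x * ?a + den (Suc k) x = lam * num k x * ?g"
    using g lam_pos by (simp add: field_simps gg[symmetric] power2_eq_square)
  moreover have "?a * den (Suc k) x - num (Suc k) x = den k x / lam"
  proof -
    have "?a * den (Suc k) x - num (Suc k) x = (?a\<^sup>2 + 1) * den k x / (lam * ?g)"
      by (simp add: add_divide_distrib power2_eq_square algebra_simps)
    then show ?thesis using g lam_pos by (simp add: g_orbit_def)
  qed
  ultimately show ?case
    using Suc g lam_pos by auto
qed

text \<open>
  In terms of the cotangent \<open>r = num / den\<close> the claim is \<open>r' \<le> - 2 ^ k / 10\<close>, written without division so
  that it also makes sense at the poles. One step of the recursion adds to the Wronskian the
  derivative of the new transfer matrix, which is \<open>- 2 ^ (k + 1) * (den (k + 1)^2 + den k^2 * (1 - a^2) / (\<lambda> g)^2)\<close>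
  with \<open>a\<close> the new cotangent. Only its second part can be positive, and since \<open>\<lambda>\<close> is large it is dominated
  by the bound already known for \<open>k\<close>. The constant \<open>1 / 10\<close> comes from \<open>k = 0\<close>, where the
  Wronskian is \<open>-1\<close> and \<open>den^2 \<le> g \<le> 10\<close>.
\<close>

lemma Wronskian_bound:
  assumes "k \<le> l" "x \<in> dcell l i"
  shows "\<exists>p q. (num k has_real_derivative p) (at x within dcell l i) \<and>
               (den k has_real_derivative q) (at x within dcell l i) \<and>
               p * den k x - num k x * q \<le> - (2 ^ k / 10) * (den k x)\<^sup>2"
  using assms
proof (induction k)
  case 0
  have a: "(cot_theta 0 has_real_derivative -1) (at x within dcell l i)"
    using frac_on_dcell_deriv[OF 0] unfolding cot_theta_def[abs_def]
    by (auto intro!: derivative_eq_intros)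
  have p: "(num 0 has_real_derivative - cos beta) (at x within dcell l i)"
    unfolding num.simps[abs_def] by (auto intro!: derivative_eq_intros a)
  have q: "(den 0 has_real_derivative - sin beta) (at x within dcell l i)"
    unfolding den.simps[abs_def] by (auto intro!: derivative_eq_intros a)
  have W: "(- cos beta) * den 0 x - num 0 x * (- sin beta) = - ((cos beta)\<^sup>2 + (sin beta)\<^sup>2)"
    by (simp add: power2_eq_square algebra_simps)
  have "(den 0 x)\<^sup>2 \<le> 10"
    using initial_norm[of x] g_orbit_bounds(2)[of 0 x] zero_le_power2[of "num 0 x"]
    by linarith
  then have "(- cos beta) * den 0 x - num 0 x * (- sin beta) \<le> - (2 ^ 0 / 10) * (den 0 x)\<^sup>2"
    unfolding W by (simp del: num.simps den.simps)
  then show ?case using p q by blast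
next
  case (Suc k)
  then obtain p q where IH: "(num k has_real_derivative p) (at x within dcell l i)"
    "(den k has_real_derivative q) (at x within dcell l i)"
    "p * den k x - num k x * q \<le> - (2 ^ k / 10) * (den k x)\<^sup>2" by auto
  define a where "a = cot_theta (Suc k) x"
  define g where "g = g_orbit (Suc k) x"
  define P where "P = num k x"
  define Q where "Q = den k x"
  define t :: real where "t = 2 ^ k"
  have t: "t > 0" by (simp add: t_def)
  have g1: "g \<ge> 1" using g_orbit_bounds(1) by (simp add: g_def)
  have ga: "g = a\<^sup>2 + 1" by (simp add: g_def g_orbit_def a_def)
  have da: "(cot_theta (Suc k) has_real_derivative - (2 * t)) (at x within dcell l i)"
    using frac_on_dcell_deriv[OF Suc.prems] unfolding cot_theta_def[abs_def] t_def
    by (auto intro!: derivative_eq_intros)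
  have dg: "(g_orbit (Suc k) has_real_derivative - (4 * t * a)) (at x within dcell l i)"
    unfolding g_orbit_def[abs_def] a_def by (auto intro!: derivative_eq_intros da)
  define p' where "p' = lam * (- (2 * t) * P + a * p) - (q * g + Q * 4 * t * a) / (lam * g\<^sup>2)"
  define q' where "q' = lam * p + ((- 2 * t * Q + a * q) * g + 4 * t * a\<^sup>2 * Q) / (lam * g\<^sup>2)"
  have g0: "g_orbit (Suc k) x \<noteq> 0" "lam \<noteq> 0" using g1 lam_pos by (auto simp: g_def)
  have dp: "(num (Suc k) has_real_derivative p') (at x within dcell l i)"
    unfolding num.simps[abs_def]
  proof (rule DERIV_cong[OF DERIV_diff[OF DERIV_mult[OF DERIV_cmult[OF da] IH(1)]
        DERIV_divide[OF IH(2) DERIV_cmult[OF dg]]]])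
    show "lam * g_orbit (Suc k) x \<noteq> 0" using g0 by simp
    show "lam * - (2 * t) * num k x + p * (lam * cot_theta (Suc k) x)
        - (q * (lam * g_orbit (Suc k) x) - den k x * (lam * - (4 * t * a)))
          / (lam * g_orbit (Suc k) x * (lam * g_orbit (Suc k) x)) = p'"
      using g0 unfolding p'_def a_def[symmetric] g_def[symmetric] P_def[symmetric] Q_def[symmetric]
      by (simp add: field_simps power2_eq_square)
  qed
  have dq: "(den (Suc k) has_real_derivative q') (at x within dcell l i)"
    unfolding den.simps[abs_def]
  proof (rule DERIV_cong[OF DERIV_add[OF DERIV_cmult[OF IH(1)]
        DERIV_divide[OF DERIV_mult[OF da IH(2)] DERIV_cmult[OF dg]]]])
    show "lam * g_orbit (Suc k) x \<noteq> 0" using g0 by simp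
    show "lam * p + ((- (2 * t) * den k x + q * cot_theta (Suc k) x) * (lam * g_orbit (Suc k) x)
        - cot_theta (Suc k) x * den k x * (lam * - (4 * t * a)))
          / (lam * g_orbit (Suc k) x * (lam * g_orbit (Suc k) x)) = q'"
      using g0 unfolding q'_def a_def[symmetric] g_def[symmetric] P_def[symmetric] Q_def[symmetric]
      by (simp add: field_simps power2_eq_square)
  qed
  define R where "R = lam * P + a * Q / (lam * g)"
  have R: "den (Suc k) x = R" by (simp add: R_def P_def Q_def a_def g_def)
  have N: "num (Suc k) x = lam * a * P - Q / (lam * g)" by (simp add: P_def Q_def a_def g_def)
  have W: "p' * R - (lam * a * P - Q / (lam * g)) * q'
     = (p * Q - P * q) - 2 * t * (R\<^sup>2 + Q\<^sup>2 * (1 - a\<^sup>2) / (lam\<^sup>2 * g\<^sup>2))"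
  proof -
    \<comment> \<open>With the inverse of \<open>lam * g\<close> as a new unknown the identity becomes polynomial.\<close>
    define m where "m = 1 / (lam * g)"
    have m: "lam * g * m = 1" using g1 lam_pos by (simp add: m_def)
    have e1: "p' = lam * (- (2 * t) * P + a * p) - (q * g + Q * 4 * t * a) * m\<^sup>2 * lam"
      using g1 lam_pos by (simp add: p'_def m_def field_simps power2_eq_square)
    have e2: "q' = lam * p + ((- 2 * t * Q + a * q) * g + 4 * t * a\<^sup>2 * Q) * m\<^sup>2 * lam"
      using g1 lam_pos by (simp add: q'_def m_def field_simps power2_eq_square)
    have e3: "R = lam * P + a * Q * m" by (simp add: R_def m_def)
    have e4: "lam * a * P - Q / (lam * g) = lam * a * P - Q * m" by (simp add: m_def)
    have e5: "Q\<^sup>2 * (1 - a\<^sup>2) / (lam\<^sup>2 * g\<^sup>2) = Q\<^sup>2 * (1 - a\<^sup>2) * m\<^sup>2"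
      by (simp add: m_def power_divide power_mult_distrib)
    show ?thesis unfolding e4 e5 unfolding e1 e2 e3 using m ga by algebra
  qed
  define c where "c = (a\<^sup>2 - 1) / (lam\<^sup>2 * g\<^sup>2)"
  have c: "c \<le> 1 / 20"
  proof -
    have "20 * (a\<^sup>2 - 1) \<le> 25 * g" using ga by simp
    also have "\<dots> \<le> 25 * g\<^sup>2" using g1 by (simp add: power2_eq_square)
    also have "\<dots> \<le> lam\<^sup>2 * g\<^sup>2" using lam_sq by (intro mult_right_mono) auto
    finally show ?thesis using g1 lam_pos by (simp add: c_def field_simps)
  qed
  have Wc: "Q\<^sup>2 * (1 - a\<^sup>2) / (lam\<^sup>2 * g\<^sup>2) = - (Q\<^sup>2 * c)"
  proof -
    have "1 - a\<^sup>2 = - (a\<^sup>2 - 1)" by simp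
    then show ?thesis unfolding c_def by (simp only: mult_minus_right minus_divide_left times_divide_eq_right)
  qed
  have "t * Q\<^sup>2 * c \<le> t * Q\<^sup>2 * (1 / 20)"
    using t c by (intro mult_left_mono) auto
  moreover have "p * Q - P * q \<le> - (t * Q\<^sup>2 / 10)" using IH(3) by (simp add: P_def Q_def t_def)
  moreover have "t * R\<^sup>2 \<ge> 0" using t by simp
  moreover have "p' * R - (lam * a * P - Q / (lam * g)) * q'
      = (p * Q - P * q) - 2 * (t * R\<^sup>2) + 2 * (t * Q\<^sup>2 * c)"
    unfolding W Wc by algebra
  ultimately have "p' * R - (lam * a * P - Q / (lam * g)) * q' \<le> - (2 * t / 10) * R\<^sup>2"
    by simp
  then show ?case
    using dp dq by (intro exI[of _ p'] exI[of _ q'] conjI) (simp_all add: R N t_def del: num.simps den.simps)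
qed

end

lemma card_le_if_bounded_gaps:
  fixes A :: "nat set"
  assumes "\<And>m n. m \<in> A \<Longrightarrow> n \<in> A \<Longrightarrow> m < n \<Longrightarrow> real n - real m < X + 1" and "0 \<le> X"
  shows "finite A \<and> real (card A) \<le> X + 2"
proof (cases "A = {}")
  case True
  then show ?thesis using assms(2) by simp
next
  case False
  define m where "m = (LEAST n. n \<in> A)"
  have m: "m \<in> A" "\<And>n. n \<in> A \<Longrightarrow> m \<le> n"
    using False unfolding m_def by (auto intro: LeastI Least_le)
  have "A \<subseteq> {m..m + nat \<lfloor>X + 1\<rfloor>}"
  proof
    fix n assume n: "n \<in> A"
    have "real n - real m < X + 1"
      using assms m n by (cases "n = m") (auto simp: le_less)
    then show "n \<in> {m..m + nat \<lfloor>X + 1\<rfloor>}" using m(2)[OF n] by simp linarith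
  qed
  then have "finite A" "card A \<le> card {m..m + nat \<lfloor>X + 1\<rfloor>}"
    by (blast intro: finite_subset card_mono finite_atLeastAtMost)+
  moreover have "real (nat \<lfloor>X + 1\<rfloor>) \<le> X + 1"
    using assms(2) by simp
  ultimately show ?thesis by simp
qed

lemma quotient_diff_le:
  fixes a b :: real
  shows "\<bar>a / (a\<^sup>2 + 1) - b / (b\<^sup>2 + 1)\<bar> \<le> \<bar>a - b\<bar>"
proof -
  have pos: "a\<^sup>2 + 1 > 0" "b\<^sup>2 + 1 > 0"
    by (auto intro: add_nonneg_pos)
  have "(1 - a * b)\<^sup>2 + (a + b)\<^sup>2 = (a\<^sup>2 + 1) * (b\<^sup>2 + 1)" by algebra
  then have "(1 - a * b)\<^sup>2 \<le> (a\<^sup>2 + 1) * (b\<^sup>2 + 1)" by (smt (verit) zero_le_power2)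
  also have "\<dots> \<le> ((a\<^sup>2 + 1) * (b\<^sup>2 + 1))\<^sup>2"
  proof (rule self_le_power)
    show "1 \<le> (a\<^sup>2 + 1) * (b\<^sup>2 + 1)"
      using mult_mono[of 1 "a\<^sup>2 + 1" 1 "b\<^sup>2 + 1"] by simp
  qed simp
  finally have "\<bar>1 - a * b\<bar> \<le> \<bar>(a\<^sup>2 + 1) * (b\<^sup>2 + 1)\<bar>"
    using abs_le_square_iff by blast
  then have "\<bar>1 - a * b\<bar> \<le> (a\<^sup>2 + 1) * (b\<^sup>2 + 1)" using pos by simp
  then have "\<bar>a - b\<bar> * (\<bar>1 - a * b\<bar> / ((a\<^sup>2 + 1) * (b\<^sup>2 + 1))) \<le> \<bar>a - b\<bar> * 1"
    using pos by (intro mult_left_mono) (auto simp: divide_le_eq_1)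
  moreover have "a / (a\<^sup>2 + 1) - b / (b\<^sup>2 + 1)
      = (a - b) * ((1 - a * b) / ((a\<^sup>2 + 1) * (b\<^sup>2 + 1)))"
    using pos by (simp add: field_simps power2_eq_square)
  ultimately show ?thesis using pos by (simp add: abs_mult)
qed

context doubling_cocycle
begin

lemma ratio_decreasing:
  assumes "k \<le> l" "u \<in> dcell l i" "v \<in> dcell l i" "u < v"
    and nz: "\<And>x. u \<le> x \<Longrightarrow> x \<le> v \<Longrightarrow> den k x \<noteq> 0"
  shows "num k u / den k u - num k v / den k v \<ge> 2 ^ k / 10 * (v - u)"
proof -
  have sub: "{u..v} \<subseteq> dcell l i" using dcell_interval assms by blast
  have "\<exists>d. ((\<lambda>x. num k x / den k x) has_real_derivative d) (at x within {u..v}) \<and> d \<le> - (2 ^ k / 10)"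
    if x: "u \<le> x" "x \<le> v" for x
  proof -
    have "x \<in> dcell l i" using sub x by auto
    then obtain p q where pq: "(num k has_real_derivative p) (at x within dcell l i)"
      "(den k has_real_derivative q) (at x within dcell l i)"
      "p * den k x - num k x * q \<le> - (2 ^ k / 10) * (den k x)\<^sup>2"
      using Wronskian_bound[OF assms(1)] by blast
    have n: "den k x \<noteq> 0" using nz x by simp
    have "((\<lambda>x. num k x / den k x) has_real_derivative
        (p * den k x - num k x * q) / (den k x * den k x)) (at x within {u..v})"
      using pq n sub by (intro DERIV_divide) (auto intro: has_field_derivative_subset)
    moreover have "(p * den k x - num k x * q) / (den k x * den k x) \<le> - (2 ^ k / 10)"
    proof -
      have "0 < den k x * den k x" using n by (metis not_real_square_gt_zero)
      then show ?thesis using pq(3) by (simp add: pos_divide_le_eq power2_eq_square)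
    qed
    ultimately show ?thesis by blast
  qed
  then obtain d where d: "\<And>x. u \<le> x \<Longrightarrow> x \<le> v \<Longrightarrow>
      ((\<lambda>x. num k x / den k x) has_real_derivative d x) (at x within {u..v}) \<and> d x \<le> - (2 ^ k / 10)"
    by metis
  then have "\<exists>x\<in>{u<..<v}. num k v / den k v - num k u / den k u = d x * (v - u)"
    using assms(4) by (intro mvt_simple) (auto simp: has_field_derivative_def)
  then obtain x where x: "x \<in> {u<..<v}" "num k v / den k v - num k u / den k u = d x * (v - u)"
    by blast
  have "d x * (v - u) \<le> - (2 ^ k / 10) * (v - u)"
    using d[of x] x assms(4) by (intro mult_right_mono) auto
  then show ?thesis using x(2) by simp
qed

section \<open>Poles and passages near the contracted direction\<close>

text \<open>
  The zeros of \<open>den k\<close> are the poles of the cotangent; their number in a cell measures how often the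
  direction turns there.
\<close>

definition zeros :: "nat \<Rightarrow> nat \<Rightarrow> nat \<Rightarrow> real set" where
  "zeros k l i = {x \<in> dcell l i. den k x = 0}"

text \<open>
  A zero of \<open>den (k + 1)\<close> is a point where the decreasing function \<open>num k / den k\<close> meets
  \<open>- a / (\<lambda>^2 g)\<close>. The latter has slope at most \<open>2 ^ (k + 1) / \<lambda>^2\<close>, far too small to meet the same
  branch of the former twice.
\<close>

lemma den_zeros_interlace:
  assumes "Suc k \<le> l" "u \<in> zeros (Suc k) l i" "v \<in> zeros (Suc k) l i" "u < v"
  shows "\<exists>s\<in>zeros k l i. u < s \<and> s < v"
proof (rule ccontr)
  assume none: "\<not> (\<exists>s\<in>zeros k l i. u < s \<and> s < v)"
  let ?a = "cot_theta (Suc k)" and ?g = "g_orbit (Suc k)"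
  have uv: "u \<in> dcell l i" "v \<in> dcell l i" "den (Suc k) u = 0" "den (Suc k) v = 0"
    using assms by (auto simp: zeros_def)
  have eq: "lam * num k x = - (?a x * den k x / (lam * ?g x))" if "den (Suc k) x = 0" for x
    using that by simp
  have end_nz: "den k x \<noteq> 0" if "den (Suc k) x = 0" for x
    using eq[OF that] num_den_nonzero[of k x] lam_pos by auto
  have nz: "den k x \<noteq> 0" if "u \<le> x" "x \<le> v" for x
  proof (cases "x = u \<or> x = v")
    case True
    then show ?thesis using uv end_nz by auto
  next
    case False
    then show ?thesis
      using that none dcell_interval[OF uv(1,2)] by (force simp: zeros_def)
  qed
  have r: "num k x / den k x = - (?a x / ?g x) / lam\<^sup>2" if "den (Suc k) x = 0" for x
    using eq[OF that] end_nz[OF that] lam_pos g_orbit_bounds(1)[of "Suc k" x]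
    by (simp add: field_simps power2_eq_square)
  have dec: "2 ^ k / 10 * (v - u) \<le> num k u / den k u - num k v / den k v"
    using assms uv nz by (intro ratio_decreasing[of k l]) auto
  have "num k u / den k u - num k v / den k v = (?a v / ?g v - ?a u / ?g u) / lam\<^sup>2"
    using uv by (simp only: r) (simp add: diff_divide_distrib)
  also have "\<dots> \<le> \<bar>?a v - ?a u\<bar> / lam\<^sup>2"
    using quotient_diff_le[of "?a v" "?a u"] by (intro divide_right_mono) (auto simp: g_orbit_def)
  also have "?a v - ?a u = - (2 ^ Suc k * (v - u))"
    using frac_on_dcell[OF assms(1) uv(1)] frac_on_dcell[OF assms(1) uv(2)]
    by (simp add: cot_theta_def algebra_simps)
  also have "\<bar>- (2 ^ Suc k * (v - u))\<bar> / lam\<^sup>2 = 2 ^ k * (v - u) * (2 / lam\<^sup>2)"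
    using assms(4) by (simp add: abs_mult)
  also have "\<dots> < 2 ^ k * (v - u) * (1 / 10)"
  proof (rule mult_strict_left_mono)
    have "25 * 2 \<le> lam\<^sup>2 * 2" using lam_sq by (intro mult_right_mono) auto
    then show "2 / lam\<^sup>2 < 1 / 10"
      using lam_sq lam_pos by (simp add: divide_less_eq)
  qed (use assms(4) in simp)
  finally show False using dec by simp
qed

lemma card_zeros_Suc:
  assumes "finite (zeros k l i)" "Suc k \<le> l"
  shows "finite (zeros (Suc k) l i) \<and> card (zeros (Suc k) l i) \<le> Suc (card (zeros k l i))"
  using assms den_zeros_interlace by (intro card_le_Suc_if_interlaced) blast+

lemma zeros_0: "finite (zeros 0 l i) \<and> card (zeros 0 l i) \<le> 1"
proof -
  have "x = y" if "x \<in> zeros 0 l i" "y \<in> zeros 0 l i" for x y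
  proof -
    have xy: "x \<in> dcell l i" "y \<in> dcell l i" "den 0 x = 0" "den 0 y = 0"
      using that by (auto simp: zeros_def)
    have s: "sin beta \<noteq> 0"
    proof
      assume "sin beta = 0"
      with xy(3) have "cos beta = 0" by simp
      with \<open>sin beta = 0\<close> show False using sin_cos_squared_add[of beta] by simp
    qed
    have "(cot_theta 0 x - cot_theta 0 y) * sin beta = 0"
      using xy(3,4) unfolding den.simps by algebra
    then have "cot_theta 0 x = cot_theta 0 y" using s by simp
    then show "x = y"
      using frac_on_dcell[of 0 l x i] frac_on_dcell[of 0 l y i] xy by (simp add: cot_theta_def)
  qed
  then have "zeros 0 l i = {} \<or> (\<exists>x. zeros 0 l i = {x})" by blast
  then show ?thesis by auto
qed

lemma finite_zeros: "k \<le> l \<Longrightarrow> finite (zeros k l i)"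
  by (induction k) (auto simp: zeros_0 card_zeros_Suc)

lemma card_zeros_add:
  "k + d \<le> l \<Longrightarrow> card (zeros (k + d) l i) \<le> card (zeros k l i) + d"
proof (induction d)
  case (Suc d)
  then have "card (zeros (Suc (k + d)) l i) \<le> Suc (card (zeros (k + d) l i))"
    using card_zeros_Suc[OF finite_zeros] by simp
  with Suc show ?case by simp
qed simp

lemma card_zeros_split:
  assumes "k \<le> l"
  shows "card (zeros k l i) = (\<Sum>j<2 ^ d. card (zeros k (l + d) (i * 2 ^ d + j)))"
proof -
  have "zeros k l i = (\<Union>j<2 ^ d. zeros k (l + d) (i * 2 ^ d + j))"
    using dcell_split[of l i d] by (auto simp: zeros_def)
  moreover have "zeros k (l + d) (i * 2 ^ d + j) \<inter> zeros k (l + d) (i * 2 ^ d + j') = {}"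
    if "j \<noteq> j'" for j j'
    using that by (auto simp: zeros_def dest: dcell_unique)
  ultimately show ?thesis
    using assms by (simp add: card_UN_disjoint finite_zeros)
qed

end

lemma sum_lessThan_mult: "(\<Sum>i<n * m. h i) = (\<Sum>i<n. \<Sum>j<m. h (i * m + j))"
  for h :: "nat \<Rightarrow> 'a::comm_monoid_add"
proof (induction n)
  case (Suc n)
  have "(\<Sum>i<Suc n * m. h i) = (\<Sum>i<n * m. h i) + (\<Sum>i=n * m..<n * m + m. h i)"
    by (simp add: add.commute lessThan_atLeast0 sum.atLeastLessThan_concat)
  also have "(\<Sum>i=n * m..<n * m + m. h i) = (\<Sum>j<m. h (n * m + j))"
    using sum.shift_bounds_nat_ivl[of h 0 "n * m" m] by (simp add: lessThan_atLeast0 add.commute)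
  finally show ?case using Suc by simp
qed simp

context doubling_cocycle
begin

text \<open>
  Averaged over the cells of level \<open>l + d\<close> inside one cell of level \<open>l\<close>, the number of poles at time
  \<open>l + d\<close> is at most \<open>N / 2 ^ d + 2\<close>, where \<open>N\<close> is the number of poles at time \<open>l\<close>. Old poles are
  distributed among the \<open>2 ^ d\<close> subcells, whereas the poles created at each new level are few in
  proportion to the number of cells: a long gap makes the cocycle forget its past.
\<close>

lemma sum_card_zeros_le:
  "(\<Sum>j<2 ^ d. card (zeros (l + d) (l + d) (i * 2 ^ d + j))) \<le> card (zeros l l i) + 2 * 2 ^ d"
proof (induction d)
  case 0
  show ?case by simp
next
  case (Suc d)
  let ?c = "\<lambda>m n j. card (zeros m n j)"
  have "(\<Sum>j<2 ^ Suc d. ?c (l + Suc d) (l + Suc d) (i * 2 ^ Suc d + j))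
      \<le> (\<Sum>j<2 ^ Suc d. ?c (l + d) (l + Suc d) (i * 2 ^ Suc d + j) + 1)"
    using card_zeros_add[of "l + d" 1 "l + Suc d"] by (intro sum_mono) simp
  also have "\<dots> = (\<Sum>j<2 ^ d * 2. ?c (l + d) (l + Suc d) (i * 2 ^ Suc d + j)) + 2 ^ Suc d"
    by (simp only: sum.distrib sum_constant card_lessThan power_Suc mult.commute) simp
  also have "(\<Sum>j<2 ^ d * 2. ?c (l + d) (l + Suc d) (i * 2 ^ Suc d + j))
      = (\<Sum>j<2 ^ d. ?c (l + d) (l + d) (i * 2 ^ d + j))"
    unfolding sum_lessThan_mult
  proof (intro sum.cong refl)
    fix j
    show "(\<Sum>j'<2. ?c (l + d) (l + Suc d) (i * 2 ^ Suc d + (j * 2 + j')))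
        = ?c (l + d) (l + d) (i * 2 ^ d + j)"
    proof -
      have eq: "i * 2 ^ Suc d + (j * 2 + j') = (i * 2 ^ d + j) * 2 ^ 1 + j'" for j'
        by (simp add: algebra_simps)
      show ?thesis
        unfolding eq using card_zeros_split[of "l + d" "l + d" "i * 2 ^ d + j" 1] by simp
    qed
  qed
  finally show ?case using Suc by simp
qed

text \<open>
  The angle is within about \<open>eta\<close> of \<open>\<pi> / 2\<close> modulo \<open>\<pi>\<close>. The strict inequality excludes the poles.
\<close>

definition near :: "real \<Rightarrow> nat \<Rightarrow> real \<Rightarrow> bool" where
  "near eta k x \<longleftrightarrow> \<bar>num k x\<bar> < eta * \<bar>den k x\<bar>"

definition hit :: "real \<Rightarrow> nat \<Rightarrow> nat \<Rightarrow> nat \<Rightarrow> bool" where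
  "hit eta k l i \<longleftrightarrow> (\<exists>x\<in>dcell l i. near eta k x)"

text \<open>
  The poles cut the cell into \<open>N + 1\<close> pieces. On each of them the cotangent decreases with slope at least
  \<open>2 ^ k / 10\<close>, so the points with \<open>near eta k\<close> lie in an interval of length \<open>20 * eta / 2 ^ k\<close>, which meets
  at most \<open>20 * eta * 2 ^ L + 2\<close> subcells.
\<close>

lemma card_hit_le:
  assumes "eta \<ge> 0"
  shows "real (card {j \<in> {..<2 ^ L}. hit eta k (k + L) (i * 2 ^ L + j)})
          \<le> (real (card (zeros k k i)) + 1) * (20 * eta * 2 ^ L + 2)"
proof -
  let ?Z = "zeros k k i" and ?J = "\<lambda>j. dcell (k + L) (i * 2 ^ L + j)"
  \<comment> \<open>Pieces between poles are indexed by the number of poles to the left.\<close>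
  let ?cl = "\<lambda>x. card {s \<in> ?Z. s < x}"
  define A where "A c = {j. j < 2 ^ L \<and> (\<exists>x\<in>?J j. near eta k x \<and> ?cl x = c)}" for c
  have fin: "finite ?Z" by (simp add: finite_zeros)
  have A: "real (card (A c)) \<le> 20 * eta * 2 ^ L + 2" for c
  proof -
    have "real n - real m < 20 * eta * 2 ^ L + 1" if mn: "m \<in> A c" "n \<in> A c" "m < n" for m n
    proof -
      obtain u v where u: "u \<in> ?J m" "near eta k u" "?cl u = c"
        and v: "v \<in> ?J n" "near eta k v" "?cl v = c" and lt: "m < 2 ^ L" "n < 2 ^ L"
        using mn by (auto simp: A_def)
      have cells: "u \<in> dcell k i" "v \<in> dcell k i"
        using u v lt dcell_split[of k i L] by blast+
      have ix: "2 ^ (k + L) * u < real (i * 2 ^ L + m) + 1" "real (i * 2 ^ L + m) \<le> 2 ^ (k + L) * u"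
         "real (i * 2 ^ L + n) \<le> 2 ^ (k + L) * v"  "2 ^ (k + L) * v < real (i * 2 ^ L + n) + 1"
        using u v by (auto simp: mem_dcell)
      have "real m + 1 \<le> real n" using mn(3) by simp
      then have "2 ^ (k + L) * u < 2 ^ (k + L) * v" using ix unfolding of_nat_add by linarith
      then have uv: "u < v" by simp
      have nz: "den k x \<noteq> 0" if x: "u \<le> x" "x \<le> v" for x
      proof
        assume x0: "den k x = 0"
        have "x \<noteq> v" using x0 v(2) by (auto simp: near_def)
        then have "x < v" using x by simp
        moreover have "x \<in> ?Z" using x x0 dcell_interval[OF cells] by (auto simp: zeros_def)
        ultimately have "x \<in> {s \<in> ?Z. s < v} - {s \<in> ?Z. s < u}" using x by simp
        moreover have "{s \<in> ?Z. s < u} \<subseteq> {s \<in> ?Z. s < v}" using uv by auto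
        ultimately have "{s \<in> ?Z. s < u} \<subset> {s \<in> ?Z. s < v}" by blast
        then have "?cl u < ?cl v" using fin by (intro psubset_card_mono) auto
        then show False using u v by simp
      qed
      have "\<bar>num k x / den k x\<bar> < eta" if "near eta k x" for x
      proof -
        have "0 < \<bar>den k x\<bar>" using that by (auto simp: near_def)
        then show ?thesis using that by (simp add: near_def pos_divide_less_eq)
      qed
      from this[OF u(2)] this[OF v(2)]
      have "num k u / den k u - num k v / den k v < 2 * eta"
        by linarith
      with ratio_decreasing[OF order_refl cells uv nz] have "2 ^ k / 10 * (v - u) < 2 * eta"
        by linarith
      then have "2 ^ L * (2 ^ k / 10 * (v - u)) < 2 ^ L * (2 * eta)" by simp
      then have "2 ^ (k + L) * v - 2 ^ (k + L) * u < 20 * eta * 2 ^ L"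
        by (simp add: power_add algebra_simps)
      then show ?thesis using ix by simp
    qed
    then show ?thesis using card_le_if_bounded_gaps[of "A c" "20 * eta * 2 ^ L"] assms by simp
  qed
  have "{j \<in> {..<2 ^ L}. hit eta k (k + L) (i * 2 ^ L + j)} \<subseteq> (\<Union>c\<in>{..card ?Z}. A c)"
  proof
    fix j assume "j \<in> {j \<in> {..<2 ^ L}. hit eta k (k + L) (i * 2 ^ L + j)}"
    then obtain x where "j < 2 ^ L" "x \<in> ?J j" "near eta k x" by (auto simp: hit_def)
    then have "j \<in> A (?cl x)" by (auto simp: A_def)
    moreover have "?cl x \<le> card ?Z" using fin by (intro card_mono) auto
    ultimately show "j \<in> (\<Union>c\<in>{..card ?Z}. A c)" by blast
  qed
  moreover have finA: "finite (A c)" for c by (auto simp: A_def)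
  ultimately have "card {j \<in> {..<2 ^ L}. hit eta k (k + L) (i * 2 ^ L + j)} \<le> card (\<Union>c\<in>{..card ?Z}. A c)"
    by (intro card_mono) auto
  also have "\<dots> \<le> (\<Sum>c\<in>{..card ?Z}. card (A c))"
    by (intro card_UN_le) simp
  finally have "real (card {j \<in> {..<2 ^ L}. hit eta k (k + L) (i * 2 ^ L + j)})
      \<le> (\<Sum>c\<in>{..card ?Z}. real (card (A c)))"
    by (metis of_nat_mono of_nat_sum)
  also have "\<dots> \<le> (\<Sum>c\<in>{..card ?Z}. 20 * eta * 2 ^ L + 2)"
    by (intro sum_mono A)
  finally show ?thesis by (simp add: algebra_simps)
qed

end

section \<open>Exponential moments of the contraction depth\<close>

lemma power_card_le_sum:
  fixes H :: "nat set"
  assumes "finite H" "0 \<notin> H"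
  shows "(3 / 2 :: real) ^ card H \<le> 1 + (\<Sum>h\<in>H. 1 / 2 * (3 / 2) ^ (h - 1))"
  using assms
proof (induction rule: finite_linorder_max_induct)
  case empty
  then show ?case by simp
next
  case (insert b A)
  have "A \<subseteq> {1..<b}" using insert by (auto simp: Suc_le_eq intro: gr0I)
  then have "card A \<le> b - 1" using card_mono[of "{1..<b}" A] by simp
  then have "(3 / 2 :: real) ^ card A \<le> (3 / 2) ^ (b - 1)" by (intro power_increasing) auto
  moreover have "(3 / 2 :: real) ^ card A \<le> 1 + (\<Sum>h\<in>A. 1 / 2 * (3 / 2) ^ (h - 1))"
    using insert by simp
  moreover have "b \<notin> A" using insert by auto
  then have "card (insert b A) = Suc (card A)"
    "(\<Sum>h\<in>insert b A. 1 / 2 * (3 / 2 :: real) ^ (h - 1))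
      = 1 / 2 * (3 / 2) ^ (b - 1) + (\<Sum>h\<in>A. 1 / 2 * (3 / 2) ^ (h - 1))"
    using insert by auto
  ultimately show ?case by (simp only: power_Suc)
qed

lemma sum_div_group:
  fixes X F :: "nat \<Rightarrow> real"
  shows "(\<Sum>i<2 ^ (l + d). X (i div 2 ^ d) * F i) = (\<Sum>i<2 ^ l. X i * (\<Sum>j<2 ^ d. F (i * 2 ^ d + j)))"
proof -
  have "(\<Sum>i<2 ^ (l + d). X (i div 2 ^ d) * F i)
      = (\<Sum>i<2 ^ l. \<Sum>j<2 ^ d. X ((i * 2 ^ d + j) div 2 ^ d) * F (i * 2 ^ d + j))"
    unfolding power_add by (rule sum_lessThan_mult)
  also have "\<dots> = (\<Sum>i<2 ^ l. \<Sum>j<2 ^ d. X i * F (i * 2 ^ d + j))"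
    by (intro sum.cong refl) simp
  finally show ?thesis by (simp add: sum_distrib_left)
qed

context doubling_cocycle
begin

text \<open>
  The depth \<open>d\<close> records, on a logarithmic scale cut off at \<open>L\<close>, how close to \<open>\<pi> / 2\<close> the angle \<open>\<theta>_k\<close> comes:
  the \<open>(k + 1)\<close>-st step loses a factor of order \<open>2 ^ d\<close> at worst. Taking the worst point of a cell of level
  \<open>k + L\<close> makes the depth constant on such cells, hence independent of the finer digits of \<open>x\<close>; the
  resolution \<open>2 ^ -L\<close> is fine enough not to spoil the tail bound for any \<open>h \<le> L\<close>.
\<close>

definition depth :: "nat \<Rightarrow> nat \<Rightarrow> nat \<Rightarrow> nat" where
  "depth L k i = card {h \<in> {1..L}. hit (1 / 2 ^ h) k (k + L) i}"

lemma depth_le: "depth L k i \<le> L"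
proof -
  have "depth L k i \<le> card {1..L}" unfolding depth_def by (intro card_mono) auto
  then show ?thesis by simp
qed

text \<open>
  The subcells of depth at least \<open>h\<close> have proportion of order \<open>(N + 1) / 2 ^ h\<close>. Any base below \<open>2\<close> therefore has a
  bounded moment; with base \<open>3 / 2\<close> the sum over \<open>h\<close> is geometric with ratio \<open>3 / 4\<close>.
\<close>

lemma depth_moment_cell:
  "(\<Sum>j<2 ^ L. (3 / 2) ^ depth L k (i * 2 ^ L + j)) \<le> 2 ^ L * (23 + 22 * real (card (zeros k k i)))"
proof -
  let ?N = "real (card (zeros k k i))"
  let ?w = "\<lambda>h. 1 / 2 * (3 / 2 :: real) ^ (h - 1)"
  let ?hit = "\<lambda>h j. hit (1 / 2 ^ h) k (k + L) (i * 2 ^ L + j)"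
  have "(3 / 2 :: real) ^ depth L k (i * 2 ^ L + j) \<le> 1 + (\<Sum>h\<in>{1..L}. ?w h * of_bool (?hit h j))" for j
  proof -
    have "(3 / 2 :: real) ^ depth L k (i * 2 ^ L + j) \<le> 1 + (\<Sum>h\<in>{h \<in> {1..L}. ?hit h j}. ?w h)"
      unfolding depth_def by (intro power_card_le_sum) auto
    also have "(\<Sum>h\<in>{h \<in> {1..L}. ?hit h j}. ?w h) = (\<Sum>h\<in>{1..L}. ?w h * of_bool (?hit h j))"
      by (rule sum.mono_neutral_cong_left) auto
    finally show ?thesis .
  qed
  then have "(\<Sum>j<2 ^ L. (3 / 2 :: real) ^ depth L k (i * 2 ^ L + j))
      \<le> (\<Sum>j<2 ^ L. 1 + (\<Sum>h\<in>{1..L}. ?w h * of_bool (?hit h j)))"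
    by (intro sum_mono)
  also have "\<dots> = 2 ^ L + (\<Sum>h\<in>{1..L}. ?w h * (\<Sum>j<2 ^ L. of_bool (?hit h j)))"
    unfolding sum.distrib sum_distrib_left by (subst sum.swap) simp
  also have "(\<Sum>h\<in>{1..L}. ?w h * (\<Sum>j<2 ^ L. of_bool (?hit h j)))
      \<le> (\<Sum>h\<in>{1..L}. 22 * (?N + 1) * 2 ^ L * (1 / 4 * (3 / 4) ^ (h - 1)))"
  proof (intro sum_mono)
    fix h assume h: "h \<in> {1..L}"
    have "(\<Sum>j<2 ^ L. of_bool (?hit h j)) = real (card {j \<in> {..<2 ^ L}. ?hit h j})"
      by (simp add: of_bool_def sum.If_cases Int_def)
    also have "\<dots> \<le> (?N + 1) * (20 * (1 / 2 ^ h) * 2 ^ L + 2)"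
      by (intro card_hit_le) simp
    also have "\<dots> \<le> (?N + 1) * (22 * 2 ^ L / 2 ^ h)"
    proof (intro mult_left_mono)
      have "(2 :: real) ^ h \<le> 2 ^ L" using h by (intro power_increasing) auto
      then show "20 * (1 / 2 ^ h) * 2 ^ L + 2 \<le> 22 * 2 ^ L / (2 :: real) ^ h"
        by (simp add: field_simps)
    qed simp
    finally have "?w h * (\<Sum>j<2 ^ L. of_bool (?hit h j)) \<le> ?w h * ((?N + 1) * (22 * 2 ^ L / 2 ^ h))"
      by (intro mult_left_mono) auto
    also have "\<dots> = 22 * (?N + 1) * 2 ^ L * (?w h / 2 ^ h)" by (simp add: field_simps)
    also have "?w h / 2 ^ h = 1 / 4 * (3 / 4) ^ (h - 1)"
    proof -
      have "h = Suc (h - 1)" using h by simp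
      then obtain m where "h = Suc m" by blast
      then show ?thesis by (simp add: power_divide power_mult_distrib[symmetric])
    qed
    finally show "?w h * (\<Sum>j<2 ^ L. of_bool (?hit h j))
        \<le> 22 * (?N + 1) * 2 ^ L * (1 / 4 * (3 / 4) ^ (h - 1))" .
  qed
  also have "\<dots> = 22 * (?N + 1) * 2 ^ L * (1 / 4 * (\<Sum>h<L. (3 / 4) ^ h))"
    unfolding sum_distrib_left
    by (rule sum.reindex_bij_witness[of _ Suc "\<lambda>h. h - 1"]) auto
  also have "\<dots> \<le> 22 * (?N + 1) * 2 ^ L * 1"
  proof (intro mult_left_mono)
    show "1 / 4 * (\<Sum>h<L. (3 / 4 :: real) ^ h) \<le> 1"
      by (subst geometric_sum) auto
  qed simp
  finally show ?thesis by (simp add: algebra_simps)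
qed

lemma depth_moment_gap:
  "(\<Sum>j<2 ^ (g + L). (3 / 2) ^ depth L (l + g) (i * 2 ^ (g + L) + j))
    \<le> 2 ^ (g + L) * (67 + 22 * (real (card (zeros l l i)) / 2 ^ g))"
proof -
  let ?N = "real (card (zeros l l i))"
  have eq: "i * 2 ^ (g + L) + (j * 2 ^ L + j') = (i * 2 ^ g + j) * 2 ^ L + j'" for j j'
    by (simp add: power_add algebra_simps)
  have "(\<Sum>j<2 ^ (g + L). (3 / 2 :: real) ^ depth L (l + g) (i * 2 ^ (g + L) + j))
      = (\<Sum>j<2 ^ g. \<Sum>j'<2 ^ L. (3 / 2 :: real) ^ depth L (l + g) ((i * 2 ^ g + j) * 2 ^ L + j'))"
    unfolding eq[symmetric] unfolding power_add[of 2 g L] by (rule sum_lessThan_mult)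
  also have "\<dots> \<le> (\<Sum>j<2 ^ g. 2 ^ L * (23 + 22 * real (card (zeros (l + g) (l + g) (i * 2 ^ g + j)))))"
    by (intro sum_mono depth_moment_cell)
  also have "\<dots> = 2 ^ L * (23 * 2 ^ g + 22 * real (\<Sum>j<2 ^ g. card (zeros (l + g) (l + g) (i * 2 ^ g + j))))"
    by (simp add: sum.distrib sum_distrib_left[symmetric] algebra_simps)
  also have "\<dots> \<le> 2 ^ L * (23 * 2 ^ g + 22 * real (card (zeros l l i) + 2 * 2 ^ g))"
    by (intro mult_left_mono add_left_mono of_nat_mono sum_card_zeros_le) auto
  also have "\<dots> = 2 ^ (g + L) * (67 + 22 * (?N / 2 ^ g))"
    by (simp add: power_add field_simps)
  finally show ?thesis .
qed

text \<open>
  The bound on the moment of the depth involves the number of poles of the starting cell, which is not bounded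
  uniformly. The remedy is to propagate the weight \<open>1 + N / 2 ^ L\<close> together with the moment: it is reproduced by a
  step with gap \<open>g = L\<close>, up to the factor \<open>135\<close>. The \<open>g + L\<close> poles created on the way cost at most \<open>1\<close> in
  the weight, and the inherited ones, multiplied by at most \<open>(3 / 2) ^ L \<le> 2 ^ L\<close>, have become rare.
\<close>

lemma weighted_moment_step:
  assumes "g + L \<le> 2 ^ L"
  shows "(\<Sum>j<2 ^ (g + L). (3 / 2) ^ depth L (l + g) (i * 2 ^ (g + L) + j) *
            (1 + real (card (zeros (l + g + L) (l + g + L) (i * 2 ^ (g + L) + j))) / 2 ^ L))
       \<le> 2 ^ (g + L) * (135 * (1 + real (card (zeros l l i)) / 2 ^ g))"
proof -
  let ?n = "\<lambda>k l j. real (card (zeros k l j))"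
  let ?N = "?n l l i" and ?l' = "l + (g + L)"
  let ?z = "\<lambda>j. (3 / 2 :: real) ^ depth L (l + g) (i * 2 ^ (g + L) + j)"
  let ?m = "\<lambda>j. ?n l ?l' (i * 2 ^ (g + L) + j)"
  have gL: "real (g + L) \<le> 2 ^ L" using assms by (metis of_nat_mono of_nat_numeral of_nat_power)
  have "?z j * (1 + ?n ?l' ?l' (i * 2 ^ (g + L) + j) / 2 ^ L) \<le> 2 * ?z j + ?m j" for j
  proof -
    have "?n ?l' ?l' (i * 2 ^ (g + L) + j) \<le> ?m j + real (g + L)"
      using card_zeros_add[of l "g + L" ?l' "i * 2 ^ (g + L) + j"] by linarith
    then have "?n ?l' ?l' (i * 2 ^ (g + L) + j) / 2 ^ L \<le> (?m j + real (g + L)) / 2 ^ L"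
      by (rule divide_right_mono) simp
    moreover have "(?m j + real (g + L)) / 2 ^ L = ?m j / 2 ^ L + real (g + L) / 2 ^ L"
      by (rule add_divide_distrib)
    moreover have "real (g + L) / 2 ^ L \<le> 1" using gL by simp
    ultimately have "1 + ?n ?l' ?l' (i * 2 ^ (g + L) + j) / 2 ^ L \<le> 2 + ?m j / 2 ^ L"
      by linarith
    then have "?z j * (1 + ?n ?l' ?l' (i * 2 ^ (g + L) + j) / 2 ^ L) \<le> ?z j * (2 + ?m j / 2 ^ L)"
      by (intro mult_left_mono) auto
    also have "?z j \<le> 2 ^ L"
    proof -
      have "?z j \<le> 2 ^ depth L (l + g) (i * 2 ^ (g + L) + j)" by (intro power_mono) auto
      also have "\<dots> \<le> 2 ^ L" by (intro power_increasing depth_le) auto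
      finally show ?thesis .
    qed
    then have "?z j * (2 + ?m j / 2 ^ L) \<le> 2 * ?z j + 2 ^ L * (?m j / 2 ^ L)"
      by (simp only: distrib_left mult.commute[of _ 2]) (intro add_left_mono mult_right_mono, auto)
    finally show ?thesis by simp
  qed
  then have "(\<Sum>j<2 ^ (g + L). ?z j * (1 + ?n ?l' ?l' (i * 2 ^ (g + L) + j) / 2 ^ L))
      \<le> (\<Sum>j<2 ^ (g + L). 2 * ?z j + ?m j)"
    by (intro sum_mono)
  also have "\<dots> = 2 * (\<Sum>j<2 ^ (g + L). ?z j) + ?N"
    using card_zeros_split[of l l i "g + L"] by (simp add: sum.distrib sum_distrib_left)
  also have "\<dots> \<le> 2 * (2 ^ (g + L) * (67 + 22 * (?N / 2 ^ g))) + 2 ^ (g + L) * (?N / 2 ^ g)"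
  proof (intro add_mono mult_left_mono depth_moment_gap)
    have "?N * 1 \<le> ?N * 2 ^ L" by (intro mult_left_mono) auto
    then show "?N \<le> 2 ^ (g + L) * (?N / 2 ^ g)" by (simp add: power_add field_simps)
  qed simp
  also have "\<dots> = 2 ^ (g + L) * (134 + 45 * (?N / 2 ^ g))" by (simp add: algebra_simps)
  also have "\<dots> \<le> 2 ^ (g + L) * (135 * (1 + ?N / 2 ^ g))"
  proof (intro mult_left_mono)
    have le: "134 + 45 * x \<le> 135 * (1 + x)" if "0 \<le> x" for x :: real using that by simp
    show "134 + 45 * (?N / 2 ^ g) \<le> 135 * (1 + ?N / 2 ^ g)" by (rule le) simp
  qed simp
  finally show ?thesis by (simp add: add.assoc)
qed

text \<open>
  The total depth over the times \<open>r, r + 2 L, \<dots>\<close>, on the cell of level \<open>l\<close> and index \<open>i\<close>; division by a power of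
  \<open>2\<close> finds the index of the coarser cell that contains it. Times in one residue class modulo \<open>2 L\<close> are far enough
  apart for \<open>weighted_moment_step\<close> to apply: \<open>L\<close> levels to resolve the depth and \<open>L\<close> levels of gap.
\<close>

definition class_depth :: "nat \<Rightarrow> nat \<Rightarrow> nat \<Rightarrow> nat \<Rightarrow> nat \<Rightarrow> nat" where
  "class_depth L r q l i = (\<Sum>p<q. depth L (r + 2 * L * p) (i div 2 ^ (l - (r + 2 * L * p + L))))"

lemma class_depth_div:
  assumes "\<And>p. p < q \<Longrightarrow> r + 2 * L * p + L \<le> l"
  shows "class_depth L r q l (i div 2 ^ d) = class_depth L r q (l + d) i"
  unfolding class_depth_def
proof (rule sum.cong[OF refl])
  fix p assume "p \<in> {..<q}"
  then have "l + d - (r + 2 * L * p + L) = d + (l - (r + 2 * L * p + L))" using assms[of p] by simp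
  then show "depth L (r + 2 * L * p) (i div 2 ^ d div 2 ^ (l - (r + 2 * L * p + L)))
      = depth L (r + 2 * L * p) (i div 2 ^ (l + d - (r + 2 * L * p + L)))"
    by (simp add: div_mult2_eq power_add)
qed

text \<open>
  The first step starts from the whole torus, where there is at most one pole, so that an arbitrary
  first gap \<open>r < 2 L\<close> is harmless.
\<close>

lemma class_moment:
  assumes "3 * L \<le> 2 ^ L" "r < 2 * L"
  shows "(\<Sum>i<2 ^ (r + 2 * L * q + L). (3 / 2) ^ class_depth L r (Suc q) (r + 2 * L * q + L) i *
            (1 + real (card (zeros (r + 2 * L * q + L) (r + 2 * L * q + L) i)) / 2 ^ L))
       \<le> 2 ^ (r + 2 * L * q + L) * (2 * 135 ^ Suc q)"
proof (induction q)
  case 0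
  have "(\<Sum>j<2 ^ (r + L). (3 / 2) ^ depth L (0 + r) (0 * 2 ^ (r + L) + j) *
            (1 + real (card (zeros (0 + r + L) (0 + r + L) (0 * 2 ^ (r + L) + j))) / 2 ^ L))
       \<le> 2 ^ (r + L) * (135 * (1 + real (card (zeros 0 0 0)) / 2 ^ r))"
    using assms by (intro weighted_moment_step) simp
  also have "\<dots> \<le> 2 ^ (r + L) * (135 * 2)"
  proof -
    have "real (card (zeros 0 0 0)) \<le> 1" using zeros_0[of 0 0] by simp
    also have "1 \<le> (2 :: real) ^ r" by simp
    finally have "real (card (zeros 0 0 0)) / 2 ^ r \<le> 1" by simp
    then show ?thesis by (intro mult_left_mono) auto
  qed
  finally show ?case by (simp add: class_depth_def)
next
  case (Suc q)
  let ?l = "r + 2 * L * q + L" and ?d = "L + L"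
  have l': "r + 2 * L * Suc q + L = ?l + ?d" by simp
  let ?X = "\<lambda>i. (3 / 2 :: real) ^ class_depth L r (Suc q) ?l i"
  let ?F = "\<lambda>i. (3 / 2) ^ depth L (?l + L) i * (1 + real (card (zeros (?l + L + L) (?l + L + L) i)) / 2 ^ L)"
  have eq: "(3 / 2) ^ class_depth L r (Suc (Suc q)) (?l + ?d) i = ?X (i div 2 ^ ?d) * (3 / 2) ^ depth L (?l + L) i" for i
  proof -
    have "class_depth L r (Suc q) ?l (i div 2 ^ ?d) = class_depth L r (Suc q) (?l + ?d) i"
      by (rule class_depth_div) auto
    moreover have "class_depth L r (Suc (Suc q)) (?l + ?d) i
        = class_depth L r (Suc q) (?l + ?d) i + depth L (?l + L) i"
      by (simp add: class_depth_def algebra_simps)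
    ultimately show ?thesis by (simp add: power_add)
  qed
  have "(\<Sum>i<2 ^ (?l + ?d). (3 / 2) ^ class_depth L r (Suc (Suc q)) (?l + ?d) i *
            (1 + real (card (zeros (?l + ?d) (?l + ?d) i)) / 2 ^ L))
      = (\<Sum>i<2 ^ (?l + ?d). ?X (i div 2 ^ ?d) * ?F i)"
    unfolding eq by (intro sum.cong refl) (simp only: mult.assoc add.assoc)
  also have "\<dots> = (\<Sum>i<2 ^ ?l. ?X i * (\<Sum>j<2 ^ ?d. ?F (i * 2 ^ ?d + j)))"
    by (rule sum_div_group)
  also have "\<dots> \<le> (\<Sum>i<2 ^ ?l. ?X i * (2 ^ ?d * (135 * (1 + real (card (zeros ?l ?l i)) / 2 ^ L))))"
    using assms by (intro sum_mono mult_left_mono weighted_moment_step) auto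
  also have "\<dots> = 2 ^ ?d * 135 * (\<Sum>i<2 ^ ?l. ?X i * (1 + real (card (zeros ?l ?l i)) / 2 ^ L))"
    unfolding sum_distrib_left by (intro sum.cong refl) (simp only: mult_ac)
  also have "\<dots> \<le> 2 ^ ?d * 135 * (2 ^ ?l * (2 * 135 ^ Suc q))"
    using Suc.IH by (intro mult_left_mono) auto
  also have "\<dots> = 2 ^ (?l + ?d) * (2 * 135 ^ Suc (Suc q))"
    by (simp only: power_add power_Suc mult_ac)
  finally show ?case unfolding l' .
qed

definition total_depth :: "nat \<Rightarrow> nat \<Rightarrow> nat \<Rightarrow> nat \<Rightarrow> nat" where
  "total_depth L n l i = (\<Sum>k<n. depth L k (i div 2 ^ (l - (k + L))))"

lemma class_moment_top:
  assumes "3 * L \<le> 2 ^ L" "r < 2 * L" and l: "l = 2 * L * Q + L"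
  shows "(\<Sum>i<2 ^ l. (3 / 2 :: real) ^ class_depth L r Q l i) \<le> 2 ^ l * (2 * 135 ^ Q)"
proof (cases Q)
  case 0
  then show ?thesis by (simp add: class_depth_def)
next
  case (Suc q)
  let ?l = "r + 2 * L * q + L" and ?d = "2 * L - r"
  have ld: "l = ?l + ?d" using Suc l assms(2) by simp
  let ?X = "\<lambda>i. (3 / 2 :: real) ^ class_depth L r Q ?l i"
  have "(\<Sum>i<2 ^ l. (3 / 2) ^ class_depth L r Q l i) = (\<Sum>i<2 ^ (?l + ?d). ?X (i div 2 ^ ?d) * 1)"
    unfolding ld using Suc
    by (intro sum.cong refl) (subst class_depth_div, auto)
  also have "\<dots> = (\<Sum>i<2 ^ ?l. ?X i * (\<Sum>j<(2::nat) ^ ?d. 1))"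
    by (rule sum_div_group)
  also have "\<dots> = 2 ^ ?d * (\<Sum>i<2 ^ ?l. ?X i * 1)" by (simp add: sum_distrib_left mult_ac)
  also have "\<dots> \<le> 2 ^ ?d * (\<Sum>i<2 ^ ?l. ?X i * (1 + real (card (zeros ?l ?l i)) / 2 ^ L))"
    by (intro mult_left_mono sum_mono) auto
  also have "\<dots> \<le> 2 ^ ?d * (2 ^ ?l * (2 * 135 ^ Suc q))"
    unfolding Suc using assms by (intro mult_left_mono class_moment) auto
  also have "\<dots> = 2 ^ l * (2 * 135 ^ Q)" unfolding ld Suc by (simp add: power_add mult_ac)
  finally show ?thesis .
qed

text \<open>
  The total depth is the sum of \<open>2 L\<close> class depths that are far from independent of each other. Convexity of the
  exponential bounds the moment with exponent \<open>1 / (2 L)\<close> by the average of the moments of the classes, without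
  the factor \<open>2 L\<close> that a union bound over the classes would cost. This exponent is the source
  of the rate \<open>n / ln \<lambda>\<close>.
\<close>

lemma total_depth_moment:
  assumes "3 * L \<le> 2 ^ L" "0 < L" and l: "l = 2 * L * Q + L"
  shows "(\<Sum>i<2 ^ l. (3 / 2) powr (real (total_depth L (2 * L * Q) l i) / real (2 * L))) \<le> 2 ^ l * (2 * 135 ^ Q)"
proof -
  let ?c = "ln (3 / 2 :: real)"
  have split: "total_depth L (2 * L * Q) l i = (\<Sum>r<2 * L. class_depth L r Q l i)" for i
  proof -
    have "total_depth L (2 * L * Q) l i
        = (\<Sum>p<Q. \<Sum>r<2 * L. depth L (p * (2 * L) + r) (i div 2 ^ (l - (p * (2 * L) + r + L))))"
      unfolding total_depth_def mult.commute[of "2 * L" Q] by (rule sum_lessThan_mult)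
    also have "\<dots> = (\<Sum>r<2 * L. class_depth L r Q l i)"
      unfolding class_depth_def by (subst sum.swap) (simp add: algebra_simps)
    finally show ?thesis .
  qed
  have jensen: "(3 / 2) powr (real (total_depth L (2 * L * Q) l i) / real (2 * L))
      \<le> (\<Sum>r<2 * L. (1 / real (2 * L)) * (3 / 2) ^ class_depth L r Q l i)" for i
  proof -
    have "(3 / 2) powr (real (total_depth L (2 * L * Q) l i) / real (2 * L))
        = exp (\<Sum>r<2 * L. (1 / real (2 * L)) *\<^sub>R (?c * real (class_depth L r Q l i)))"
      unfolding split by (simp add: powr_def sum_distrib_left sum_divide_distrib mult_ac)
    also have "\<dots> \<le> (\<Sum>r<2 * L. (1 / real (2 * L)) * exp (?c * real (class_depth L r Q l i)))"
      using assms(2) by (intro convex_on_sum[OF _ _ exp_convex]) (auto simp: lessThan_empty_iff)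
    also have "\<dots> = (\<Sum>r<2 * L. (1 / real (2 * L)) * (3 / 2) ^ class_depth L r Q l i)"
      by (simp add: powr_realpow[symmetric] powr_def mult.commute)
    finally show ?thesis .
  qed
  have "(\<Sum>i<2 ^ l. (3 / 2) powr (real (total_depth L (2 * L * Q) l i) / real (2 * L)))
      \<le> (\<Sum>i<2 ^ l. \<Sum>r<2 * L. (1 / real (2 * L)) * (3 / 2) ^ class_depth L r Q l i)"
    by (intro sum_mono jensen)
  also have "\<dots> = (\<Sum>r<2 * L. (1 / real (2 * L)) * (\<Sum>i<2 ^ l. (3 / 2) ^ class_depth L r Q l i))"
    by (subst sum.swap) (simp add: sum_distrib_left)
  also have "\<dots> \<le> (\<Sum>r<2 * L. (1 / real (2 * L)) * (2 ^ l * (2 * 135 ^ Q)))"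
    using assms by (intro sum_mono mult_left_mono class_moment_top) auto
  also have "\<dots> = 2 ^ l * (2 * 135 ^ Q)" using assms(2) by simp
  finally show ?thesis .
qed

lemma card_large_total_depth:
  assumes "3 * L \<le> 2 ^ L" "0 < L" and l: "l = 2 * L * Q + L"
  shows "real (card {i \<in> {..<2 ^ l}. y < real (total_depth L (2 * L * Q) l i)})
      \<le> 2 ^ l * (2 * 135 ^ Q) * (3 / 2) powr (- (y / real (2 * L)))"
proof -
  let ?B = "{i \<in> {..<2 ^ l}. y < real (total_depth L (2 * L * Q) l i)}"
  let ?t = "\<lambda>i. (3 / 2) powr (real (total_depth L (2 * L * Q) l i) / real (2 * L))"
  have "real (card ?B) * (3 / 2) powr (y / real (2 * L)) = (\<Sum>i\<in>?B. (3 / 2) powr (y / real (2 * L)))"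
    by simp
  also have "\<dots> \<le> (\<Sum>i\<in>?B. ?t i)"
    by (intro sum_mono powr_mono divide_right_mono) auto
  also have "\<dots> \<le> (\<Sum>i<2 ^ l. ?t i)" by (intro sum_mono2) auto
  also have "\<dots> \<le> 2 ^ l * (2 * 135 ^ Q)" using assms by (rule total_depth_moment)
  finally show ?thesis
    by (simp add: powr_minus divide_simps)
qed

section \<open>Growth of the vector along the orbit\<close>

definition sq_norm :: "nat \<Rightarrow> real \<Rightarrow> real" where
  "sq_norm k x = (num k x)\<^sup>2 + (den k x)\<^sup>2"

lemma sq_norm_pos: "sq_norm k x > 0"
  using num_den_nonzero[of k x] by (auto simp: sq_norm_def sum_power2_gt_zero_iff)

lemma sq_norm_Suc:
  "sq_norm (Suc k) x = lam\<^sup>2 * g_orbit (Suc k) x * (num k x)\<^sup>2 + (den k x)\<^sup>2 / (lam\<^sup>2 * g_orbit (Suc k) x)"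
proof -
  define a where "a = cot_theta (Suc k) x"
  define g where "g = g_orbit (Suc k) x"
  define m where "m = 1 / (lam * g)"
  have g: "g \<ge> 1" "g = a\<^sup>2 + 1" using g_orbit_bounds(1)[of "Suc k" x] by (auto simp: g_def a_def g_orbit_def)
  have m: "lam * g * m = 1" using g(1) lam_pos by (simp add: m_def)
  have e: "(den k x)\<^sup>2 / (lam\<^sup>2 * g) = (den k x)\<^sup>2 * m\<^sup>2 * g"
  proof -
    have "g \<noteq> 0" using g(1) by linarith
    then show ?thesis using lam_pos by (simp add: m_def field_simps power2_eq_square)
  qed
  have "num (Suc k) x = lam * a * num k x - den k x * m"
    "den (Suc k) x = lam * num k x + a * den k x * m"
    by (simp_all add: a_def g_def m_def)
  then show ?thesis
    unfolding sq_norm_def g_def[symmetric] e using m g(2) by algebra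
qed

lemma sq_norm_upper: "sq_norm n x \<le> (10 * lam\<^sup>2) ^ n * sq_norm 0 x"
proof (induction n)
  case (Suc n)
  have g: "1 \<le> g_orbit (Suc n) x" "g_orbit (Suc n) x \<le> 10" by (rule g_orbit_bounds)+
  have "lam\<^sup>2 * g_orbit (Suc n) x \<ge> 1" using g lam_sq mult_mono[of 1 "lam\<^sup>2" 1 "g_orbit (Suc n) x"] by simp
  then have "(den n x)\<^sup>2 / (lam\<^sup>2 * g_orbit (Suc n) x) \<le> (den n x)\<^sup>2 * 1"
    by (simp add: divide_le_eq mult_left_le mult_le_cancel_left1)
  also have "\<dots> \<le> (den n x)\<^sup>2 * (10 * lam\<^sup>2)" using lam_sq by (intro mult_left_mono) auto
  finally have "(den n x)\<^sup>2 / (lam\<^sup>2 * g_orbit (Suc n) x) \<le> 10 * lam\<^sup>2 * (den n x)\<^sup>2" by (simp add: mult_ac)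
  moreover have "lam\<^sup>2 * g_orbit (Suc n) x * (num n x)\<^sup>2 \<le> lam\<^sup>2 * 10 * (num n x)\<^sup>2"
    using g by (intro mult_left_mono mult_right_mono) auto
  ultimately have "sq_norm (Suc n) x \<le> 10 * lam\<^sup>2 * sq_norm n x"
    unfolding sq_norm_Suc by (simp add: sq_norm_def algebra_simps)
  also have "\<dots> \<le> 10 * lam\<^sup>2 * ((10 * lam\<^sup>2) ^ n * sq_norm 0 x)"
    using Suc by (intro mult_left_mono) auto
  finally show ?case by (simp add: mult_ac)
qed simp

lemma not_near_depth:
  assumes "x \<in> dcell (k + L) i" "depth L k i < L"
  shows "\<not> near (1 / 2 ^ Suc (depth L k i)) k x"
proof
  assume n: "near (1 / 2 ^ Suc (depth L k i)) k x"
  have "{1..Suc (depth L k i)} \<subseteq> {h \<in> {1..L}. hit (1 / 2 ^ h) k (k + L) i}"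
  proof
    fix h assume h: "h \<in> {1..Suc (depth L k i)}"
    have "(1 :: real) / 2 ^ Suc (depth L k i) \<le> 1 / 2 ^ h"
      using h by (intro divide_left_mono power_increasing) auto
    then have "1 / 2 ^ Suc (depth L k i) * \<bar>den k x\<bar> \<le> 1 / 2 ^ h * \<bar>den k x\<bar>"
      by (intro mult_right_mono) auto
    then have "near (1 / 2 ^ h) k x" using n unfolding near_def by linarith
    then show "h \<in> {h \<in> {1..L}. hit (1 / 2 ^ h) k (k + L) i}"
      using h assms by (auto simp: hit_def)
  qed
  then have "card {1..Suc (depth L k i)} \<le> depth L k i"
    unfolding depth_def by (intro card_mono) auto
  then show False by simp
qed

text \<open>
  If the depth is below \<open>L\<close>, the expanded coordinate alone accounts for the claim. If it equals \<open>L\<close>, nothing is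
  known about the angle, but the contraction by \<open>\<Lambda>\<close> is never worse than \<open>1 / (\<lambda> sqrt 10)\<close>, and the
  choice \<open>2 ^ L \<ge> 4 \<lambda>^2\<close> makes this compatible with the claim.
\<close>

lemma sq_norm_lower_step:
  assumes x: "x \<in> dcell (k + L) i" and L: "4 * lam\<^sup>2 \<le> 2 ^ L"
  shows "lam\<^sup>2 * sq_norm k x / (2 * 4 ^ Suc (depth L k i)) \<le> sq_norm (Suc k) x"
proof -
  let ?d = "depth L k i"
  define P where "P = (num k x)\<^sup>2"
  define Q where "Q = (den k x)\<^sup>2"
  have PQ: "P \<ge> 0" "Q \<ge> 0" by (auto simp: P_def Q_def)
  have g: "1 \<le> g_orbit (Suc k) x" "g_orbit (Suc k) x \<le> 10" by (rule g_orbit_bounds)+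
  have Pb: "lam\<^sup>2 * P \<le> lam\<^sup>2 * g_orbit (Suc k) x * P"
    using g PQ by (simp add: mult_right_mono mult_le_cancel_left1)
  have Qb: "Q / (lam\<^sup>2 * 10) \<le> Q / (lam\<^sup>2 * g_orbit (Suc k) x)"
    using g PQ lam_pos by (intro divide_left_mono mult_left_mono) auto
  have n: "sq_norm (Suc k) x = lam\<^sup>2 * g_orbit (Suc k) x * P + Q / (lam\<^sup>2 * g_orbit (Suc k) x)"
    by (simp add: sq_norm_Suc P_def Q_def)
  have nk: "sq_norm k x = P + Q" by (simp add: sq_norm_def P_def Q_def)
  have p4: "(4 :: real) ^ Suc ?d \<ge> 1" by (rule one_le_power) simp
  have small: "P / 4 ^ Suc ?d \<le> P" using p4 PQ by (simp add: divide_le_eq mult_le_cancel_left1 del: power_Suc)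
  show ?thesis
  proof (cases "?d < L")
    case True
    then have "\<bar>den k x\<bar> / 2 ^ Suc ?d \<le> \<bar>num k x\<bar>"
      using not_near_depth[OF x] by (simp add: near_def)
    then have "(\<bar>den k x\<bar> / 2 ^ Suc ?d)\<^sup>2 \<le> \<bar>num k x\<bar>\<^sup>2" by (intro power_mono) auto
    moreover have "((2 :: real) ^ Suc ?d)\<^sup>2 = 4 ^ Suc ?d"
      by (metis power2_eq_square power_mult_distrib mult_2 numeral_Bit0 power_mult power_even_eq mult.commute)
    ultimately have "Q / 4 ^ Suc ?d \<le> P" by (simp add: P_def Q_def power_divide)
    with small have "(P + Q) / 4 ^ Suc ?d \<le> 2 * P" by (simp add: add_divide_distrib)
    then have "lam\<^sup>2 / 2 * ((P + Q) / 4 ^ Suc ?d) \<le> lam\<^sup>2 / 2 * (2 * P)"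
      by (intro mult_left_mono) auto
    then have "lam\<^sup>2 * sq_norm k x / (2 * 4 ^ Suc ?d) \<le> lam\<^sup>2 * P" by (simp add: nk)
    moreover have "0 \<le> Q / (lam\<^sup>2 * 10)" using PQ by simp
    ultimately show ?thesis using Pb Qb n by linarith
  next
    case False
    then have d: "?d = L" using depth_le[of L k i] by simp
    have "(4 * lam\<^sup>2)\<^sup>2 \<le> (2 ^ L)\<^sup>2" using L by (intro power_mono) auto
    also have "((2 :: real) ^ L)\<^sup>2 = 4 ^ L"
      by (simp add: power2_eq_square power_mult_distrib[symmetric])
    finally have l4: "16 * lam\<^sup>2 * lam\<^sup>2 \<le> 4 ^ L" by (simp add: power2_eq_square mult_ac)
    have "lam\<^sup>2 * P / (2 * 4 ^ Suc ?d) \<le> lam\<^sup>2 * P"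
    proof -
      have "lam\<^sup>2 * (P / 4 ^ Suc ?d) \<le> lam\<^sup>2 * P" using small by (intro mult_left_mono) auto
      moreover have "0 \<le> lam\<^sup>2 * (P / 4 ^ Suc ?d)" using PQ by simp
      ultimately show ?thesis by simp
    qed
    moreover have "lam\<^sup>2 * Q / (2 * 4 ^ Suc ?d) \<le> Q / (lam\<^sup>2 * 10)"
    proof -
      have "lam\<^sup>2 * Q * (lam\<^sup>2 * 10) \<le> Q * (16 * lam\<^sup>2 * lam\<^sup>2)" using PQ by (simp add: mult_ac mult_right_mono)
      also have "\<dots> \<le> Q * (4 ^ L)" using l4 PQ by (intro mult_left_mono) auto
      also have "\<dots> \<le> Q * (2 * 4 ^ Suc ?d)" using d PQ by (intro mult_left_mono) auto
      finally show ?thesis using lam_pos by (simp add: pos_divide_le_eq pos_le_divide_eq mult_ac del: power_Suc)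
    qed
    ultimately have "lam\<^sup>2 * sq_norm k x / (2 * 4 ^ Suc ?d) \<le> lam\<^sup>2 * P + Q / (lam\<^sup>2 * 10)"
      by (simp add: nk distrib_left add_divide_distrib)
    then show ?thesis using Pb Qb n by linarith
  qed
qed

lemma ln_sq_norm_lower:
  assumes x: "x \<in> dcell l i" and L: "4 * lam\<^sup>2 \<le> 2 ^ L"
  shows "n + L \<le> l \<Longrightarrow>
    ln (sq_norm 0 x) + 2 * real n * ln lam - (3 * real n + 2 * real (total_depth L n l i)) * ln 2 \<le> ln (sq_norm n x)"
proof (induction n)
  case 0
  then show ?case by (simp add: total_depth_def)
next
  case (Suc n)
  let ?d = "depth L n (i div 2 ^ (l - (n + L)))"
  have "x \<in> dcell (n + L) (i div 2 ^ (l - (n + L)))"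
    using x Suc.prems dcell_coarsen[of x "n + L" "l - (n + L)" i] by simp
  from sq_norm_lower_step[OF this L]
  have "ln (lam\<^sup>2 * sq_norm n x / (2 * 4 ^ Suc ?d)) \<le> ln (sq_norm (Suc n) x)"
    using lam_pos sq_norm_pos[of n x] sq_norm_pos[of "Suc n" x]
    by (intro ln_mono divide_pos_pos mult_pos_pos) auto
  moreover have "ln (lam\<^sup>2 * sq_norm n x / (2 * 4 ^ Suc ?d))
      = 2 * ln lam + ln (sq_norm n x) - (3 + 2 * real ?d) * ln 2"
  proof -
    have l4: "ln (4 :: real) = 2 * ln 2" using ln_realpow[of 2 2] by simp
    have "ln (lam\<^sup>2 * sq_norm n x / (2 * 4 ^ Suc ?d)) = ln (lam\<^sup>2 * sq_norm n x) - ln (2 * 4 ^ Suc ?d)"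
    proof (rule ln_divide_pos)
      show "0 < lam\<^sup>2 * sq_norm n x" using lam_pos sq_norm_pos[of n x] by simp
      show "0 < 2 * (4 :: real) ^ Suc ?d" by simp
    qed
    also have "ln (lam\<^sup>2 * sq_norm n x) = 2 * ln lam + ln (sq_norm n x)"
      using lam_pos sq_norm_pos[of n x] by (simp add: ln_mult ln_realpow)
    also have "ln (2 * (4 :: real) ^ Suc ?d) = ln 2 + real (Suc ?d) * ln 4"
      by (subst ln_mult_pos) (simp_all only: ln_realpow zero_less_numeral zero_less_power)
    finally show ?thesis using l4 by (simp add: algebra_simps)
  qed
  moreover have "total_depth L (Suc n) l i = total_depth L n l i + ?d" by (simp add: total_depth_def)
  ultimately show ?case using Suc by (simp add: algebra_simps)
qed

end

section \<open>The matrix cocycle in terms of the recursion\<close>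

lemma theta_eq: "theta f lam E x = pi / 2 - arctan (E / lam - f x)"
proof -
  let ?y = "E / lam - f x"
  have "cot (pi / 2 - arctan ?y) = tan (arctan ?y)"
    by (simp add: cot_def tan_def sin_diff cos_diff)
  then have "0 < pi / 2 - arctan ?y \<and> pi / 2 - arctan ?y < pi \<and> cot (pi / 2 - arctan ?y) = ?y"
    using arctan_bounded[of ?y] by (auto simp: tan_arctan)
  then show ?thesis
    unfolding theta_def using ex1_cot[of ?y] by (intro the1_equality) auto
qed

lemma sin_theta: "sin (theta f lam E x) = 1 / sqrt (gfun f lam E x)"
  by (simp add: theta_eq sin_diff cos_arctan gfun_def add.commute)

lemma cos_theta: "cos (theta f lam E x) = (E / lam - f x) / sqrt (gfun f lam E x)"
  by (simp add: theta_eq cos_diff sin_arctan gfun_def add.commute)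

lemma rot_mult: "(rot t *v v) $ 1 = cos t * v $ 1 - sin t * v $ 2"
    "(rot t *v v) $ 2 = sin t * v $ 1 + cos t * v $ 2"
  by (simp_all add: rot_def matrix_vector_mult_def sum_2)

lemma norm_real2: "norm v = sqrt ((v $ 1)\<^sup>2 + (v $ 2)\<^sup>2)" for v :: "real ^ 2"
  by (simp add: norm_vec_def L2_set_def sum_2)

lemma norm_rot: "norm (rot t *v v) = norm v"
proof -
  have "(cos t * v $ 1 - sin t * v $ 2)\<^sup>2 + (sin t * v $ 1 + cos t * v $ 2)\<^sup>2
      = ((cos t)\<^sup>2 + (sin t)\<^sup>2) * ((v $ 1)\<^sup>2 + (v $ 2)\<^sup>2)" by algebra
  then show ?thesis by (simp add: norm_real2 rot_mult)
qed

context doubling_cocycle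
begin

lemma rotated_vvec:
  assumes f: "\<And>y. y \<in> {0..<1} \<Longrightarrow> f y = y" and x: "x \<in> {0..<1}" and E: "E / lam = e"
  shows "rot (theta f lam E ((doubling ^^ k) x)) *v vvec f lam E beta k x
       = vector [num k x / sqrt (g_orbit 0 x), den k x / sqrt (g_orbit 0 x)]"
proof (induction k)
  have y: "(doubling ^^ k) x = frac (2 ^ k * x)" for k by (rule iterated_doubling[OF x])
  have g: "gfun f lam E ((doubling ^^ k) x) = g_orbit k x" for k
    by (simp add: y gfun_def g_orbit_def cot_theta_def E f frac_ge_0 frac_lt_1)
  have th: "sin (theta f lam E ((doubling ^^ k) x)) = 1 / sqrt (g_orbit k x)"
    "cos (theta f lam E ((doubling ^^ k) x)) = cot_theta k x / sqrt (g_orbit k x)" for k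
    unfolding sin_theta cos_theta g by (simp_all add: y cot_theta_def E f frac_ge_0 frac_lt_1)
  {
    case 0
    then show ?case
      using th[of 0] by (simp add: vec_eq_iff forall_2 rot_mult vvec_def unit_vec_def add_divide_distrib diff_divide_distrib)
  next
    case (Suc k)
    let ?V = "vvec f lam E beta"
    define s where "s = sqrt (g_orbit (Suc k) x)"
    define c where "c = sqrt (g_orbit 0 x)"
    have pos: "s > 0" "c > 0"
      using g_orbit_bounds(1)[of "Suc k" x] g_orbit_bounds(1)[of 0 x] by (auto simp: s_def c_def)
    have s2: "g_orbit (Suc k) x = s * s"
      using g_orbit_bounds(1)[of "Suc k" x] by (simp add: s_def)
    have V: "?V (Suc k) x = Lam f lam E ((doubling ^^ Suc k) x) *v (rot (theta f lam E ((doubling ^^ k) x)) *v ?V k x)"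
      by (simp add: vvec_def Bmat_def matrix_vector_mul_assoc matrix_mul_assoc)
    have V12: "?V (Suc k) x $ 1 = lam * s * (num k x / c)" "?V (Suc k) x $ 2 = (den k x / c) / (lam * s)"
      unfolding V Suc.IH Lam_def g s_def c_def by (simp_all add: matrix_vector_mult_def sum_2 divide_inverse)
    have "(rot (theta f lam E ((doubling ^^ Suc k) x)) *v ?V (Suc k) x) $ 1 = num (Suc k) x / c"
      unfolding rot_mult V12 th s_def[symmetric] num.simps s2 using pos lam_pos
      by (simp add: field_simps)
    moreover have "(rot (theta f lam E ((doubling ^^ Suc k) x)) *v ?V (Suc k) x) $ 2 = den (Suc k) x / c"
      unfolding rot_mult V12 th s_def[symmetric] den.simps s2 using pos lam_pos
      by (simp add: field_simps)
    ultimately show ?case by (simp only: vec_eq_iff forall_2 vector_2 c_def)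
  }
qed

text \<open>
  Rotations preserve the norm, so the norm of \<open>v_n\<close> can be read off from \<open>R_\<theta>(T^n x) v_n\<close>.
\<close>

lemma ln_norm_vvec:
  assumes "\<And>y. y \<in> {0..<1} \<Longrightarrow> f y = y" and "x \<in> {0..<1}" and "E / lam = e"
  shows "ln (norm (vvec f lam E beta n x)) = (ln (sq_norm n x) - ln (sq_norm 0 x)) / 2"
proof -
  have g: "g_orbit 0 x = sq_norm 0 x" using initial_norm by (simp add: sq_norm_def)
  have "norm (vvec f lam E beta n x)
      = norm (vector [num n x / sqrt (g_orbit 0 x), den n x / sqrt (g_orbit 0 x)] :: real ^ 2)"
    using norm_rot[of "theta f lam E ((doubling ^^ n) x)" "vvec f lam E beta n x"]
      rotated_vvec[OF assms, of n] by simp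
  also have "\<dots> = sqrt ((num n x / sqrt (g_orbit 0 x))\<^sup>2 + (den n x / sqrt (g_orbit 0 x))\<^sup>2)"
    by (simp add: norm_real2)
  also have "\<dots> = sqrt (sq_norm n x / sq_norm 0 x)"
    using sq_norm_pos[of 0 x] unfolding g by (simp add: power_divide sq_norm_def[of n] add_divide_distrib)
  finally show ?thesis
    using sq_norm_pos[of 0 x] sq_norm_pos[of n x] by (simp add: ln_sqrt ln_div)
qed

lemma ln_norm_vvec_upper:
  assumes "\<And>y. y \<in> {0..<1} \<Longrightarrow> f y = y" and "x \<in> {0..<1}" and "E / lam = e"
  shows "ln (norm (vvec f lam E beta n x)) \<le> real n * (ln lam + ln 10 / 2)"
proof -
  have "ln (sq_norm n x) \<le> ln ((10 * lam\<^sup>2) ^ n * sq_norm 0 x)"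
    by (intro ln_mono sq_norm_upper sq_norm_pos)
  also have "\<dots> = ln ((10 * lam\<^sup>2) ^ n) + ln (sq_norm 0 x)"
    using sq_norm_pos[of 0 x] lam_pos by (intro ln_mult_pos) auto
  also have "ln ((10 * lam\<^sup>2) ^ n) = real n * (ln 10 + 2 * ln lam)"
    using lam_pos by (simp add: ln_realpow ln_mult algebra_simps)
  finally have "ln (sq_norm n x) - ln (sq_norm 0 x) \<le> real n * (ln 10 + 2 * ln lam)" by simp
  moreover have "ln (norm (vvec f lam E beta n x)) = (ln (sq_norm n x) - ln (sq_norm 0 x)) / 2"
    by (rule ln_norm_vvec[OF assms])
  ultimately show ?thesis by (simp add: field_simps)
qed

lemma ln_norm_vvec_lower:
  assumes "\<And>y. y \<in> {0..<1} \<Longrightarrow> f y = y" and "x \<in> {0..<1}" and "E / lam = e"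
    and "x \<in> dcell l i" and "4 * lam\<^sup>2 \<le> 2 ^ L" and "n + L \<le> l"
  shows "real n * ln lam - (3 / 2 * real n + real (total_depth L n l i)) * ln 2
      \<le> ln (norm (vvec f lam E beta n x))"
proof -
  have v: "ln (norm (vvec f lam E beta n x)) = (ln (sq_norm n x) - ln (sq_norm 0 x)) / 2"
    by (rule ln_norm_vvec[OF assms(1-3)])
  show ?thesis
    unfolding v using ln_sq_norm_lower[OF assms(4-6)] by (simp add: algebra_simps)
qed

end

section \<open>A lower bound for the constant of the angle estimate\<close>

lemma rp1_norm_le:
  assumes "cis t = cis u"
  shows "rp1_norm (t - pi / 2) \<le> \<bar>u - pi / 2\<bar>"
proof -
  have "sin t = sin u \<and> cos t = cos u" using assms by (metis cis.sel)
  then obtain m :: int where m: "t = u + 2 * pi * of_int m" unfolding sin_cos_eq_iff by auto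
  have "rp1_norm (t - pi / 2) \<le> dist (t - pi / 2) (pi * of_int (2 * m))"
    unfolding rp1_norm_def by (rule infdist_le) blast
  then show ?thesis by (simp add: dist_real_def m algebra_simps)
qed

text \<open>
  For \<open>E = - 2 \<lambda>\<close> the angle \<open>\<theta>(x) = \<pi> / 2 + arctan (2 + x)\<close> has derivative at most \<open>1 / 5\<close>. With the initial
  direction chosen such that \<open>\<theta>_0(0) = \<pi> / 2\<close>, every \<open>x\<close> in the torus satisfies \<open>\<bar>\<theta>_0(x) - \<pi> / 2\<bar> < 1 / 5\<close>,
  and the angle estimate for \<open>\<delta> = 1 / 5\<close> forces \<open>1 < Cf / 5\<close>.
\<close>

lemma angle_constant_gt_5:
  assumes f: "\<And>y. y \<in> {0..<1} \<Longrightarrow> f y = y" and ac: "angle_constant f Cf"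
  shows "Cf > 5"
proof -
  have "\<forall>\<^sub>F lam in at_top. lam > 0 \<and> (\<forall>E\<in>{- 2 * lam..2 * lam}. \<forall>\<beta> n. \<forall>\<delta>>0.
          mes_torus (\<lambda>x. rp1_norm (theta_iter f lam E \<beta> n x - pi / 2) < \<delta>) < Cf * \<delta>)"
    using ac eventually_gt_at_top[of "0::real"] by (auto simp: angle_constant_def eventually_conj_iff)
  then have "\<exists>lam. lam > 0 \<and> (\<forall>E\<in>{- 2 * lam..2 * lam}. \<forall>\<beta> n. \<forall>\<delta>>0.
          mes_torus (\<lambda>x. rp1_norm (theta_iter f lam E \<beta> n x - pi / 2) < \<delta>) < Cf * \<delta>)"
    by (rule eventually_happens'[OF trivial_limit_at_top_linorder])
  then obtain lam where lam: "lam > 0"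
    and est: "\<And>E \<beta> n \<delta>. E \<in> {- 2 * lam..2 * lam} \<Longrightarrow> \<delta> > 0 \<Longrightarrow>
       mes_torus (\<lambda>x. rp1_norm (theta_iter f lam E \<beta> n x - pi / 2) < \<delta>) < Cf * \<delta>"
    by blast
  define E where "E = - 2 * lam"
  define \<beta> where "\<beta> = - arctan 2"
  have close: "rp1_norm (theta_iter f lam E \<beta> 0 x - pi / 2) < 1 / 5" if x: "x \<in> {0..<1}" for x
  proof -
    let ?u = "theta f lam E x + \<beta>"
    have u: "?u = pi / 2 + (arctan (2 + x) - arctan 2)"
      using lam arctan_minus[of "2 + x"] by (simp add: theta_eq E_def \<beta>_def f[OF x])
    have "0 \<le> arctan (2 + x) - arctan 2" using x arctan_monotone'[of 2 "2 + x"] by simp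
    moreover have "arctan (2 + x) - arctan 2 < 1 / 5"
    proof (cases "x = 0")
      case False
      with x have "2 < 2 + x" by simp
      from MVT2[OF this, of arctan "\<lambda>y. inverse (1 + y\<^sup>2)"]
      obtain z where z: "2 < z" "arctan (2 + x) - arctan 2 = x * inverse (1 + z\<^sup>2)"
        by (auto intro: DERIV_arctan)
      have "2\<^sup>2 < z\<^sup>2" using z(1) by (intro power_strict_mono) auto
      then have "x * inverse (1 + z\<^sup>2) \<le> x * (1 / 5)"
        using x by (intro mult_left_mono) (auto simp: inverse_eq_divide field_simps)
      then show ?thesis using x z by simp
    qed simp
    moreover have "cis (theta_iter f lam E \<beta> 0 x) = cis ?u"
    proof -
      have "theta_iter f lam E \<beta> 0 x = Arg (cis ?u)"
        by (simp add: theta_iter_def vec_arg_def rot_mult vvec_def unit_vec_def complex_eq_iff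
            cos_add sin_add cis.ctr add.commute mult.commute)
      then show ?thesis by (simp add: cis_Arg sgn_eq)
    qed
    then have "rp1_norm (theta_iter f lam E \<beta> 0 x - pi / 2) \<le> \<bar>?u - pi / 2\<bar>"
      by (rule rp1_norm_le)
    ultimately show ?thesis unfolding u by simp
  qed
  then have "{x \<in> {0..<1}. rp1_norm (theta_iter f lam E \<beta> 0 x - pi / 2) < 1 / 5} = {0..<1}" by auto
  then have "mes_torus (\<lambda>x. rp1_norm (theta_iter f lam E \<beta> 0 x - pi / 2) < 1 / 5) = 1"
    unfolding mes_torus_def by simp
  then show ?thesis using est[of E "1 / 5" \<beta> 0] lam by (simp add: E_def)
qed

section \<open>The large deviation estimate\<close>

text \<open>
  The set in \<open>mes_torus\<close> may fail to be measurable, in which case its measure is \<open>0\<close> by convention.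
\<close>

lemma mes_torus_le_card_dcells:
  assumes "\<And>x. x \<in> {0..<1} \<Longrightarrow> P x \<Longrightarrow> \<exists>i\<in>B. x \<in> dcell l i" and B: "finite B"
  shows "mes_torus P \<le> real (card B) / 2 ^ l"
proof -
  let ?S = "{x \<in> {0..<1}. P x}"
  have cell: "measure lebesgue (dcell l i) = 1 / 2 ^ l" for i
    by (simp add: dcell_def divide_right_mono diff_divide_distrib[symmetric])
  have "measure lebesgue ?S \<le> measure lebesgue (\<Union>i\<in>B. dcell l i)"
  proof (cases "?S \<in> sets lebesgue")
    case True
    have "dcell l i \<in> lmeasurable" for i
      unfolding dcell_def by (rule bounded_set_imp_lmeasurable) auto
    then have "(\<Union>i\<in>B. dcell l i) \<in> lmeasurable"
      using B by (intro fmeasurable.finite_UN) auto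
    then show ?thesis
      using assms True by (intro measure_mono_fmeasurable) blast+
  next
    case False
    then show ?thesis by (simp add: measure_notin_sets)
  qed
  also have "\<dots> \<le> (\<Sum>i\<in>B. measure lebesgue (dcell l i))"
    using B by (intro measure_UNION_le) (auto simp: dcell_def)
  finally show ?thesis by (simp add: mes_torus_def cell)
qed

text \<open>
  The depth cutoff has to resolve angles of order \<open>\<lambda>^-2\<close>, which forces \<open>L\<close> to be of order \<open>ln \<lambda>\<close>.
\<close>

lemma depth_cutoff_exists:
  fixes lam :: real
  assumes lam: "lam \<ge> exp 4"
  obtains L :: nat where "4 * lam\<^sup>2 \<le> 2 ^ L" "3 * L \<le> 2 ^ L" "0 < L" "real L \<le> 4 * ln lam"
proof -
  have e4: "exp 4 \<ge> (5 :: real)" using exp_ge_add_one_self[of 4] by simp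
  then have l5: "lam \<ge> 5" using lam by linarith
  have ln4: "ln lam \<ge> 4" using lam l5 by (simp add: ln_ge_iff)
  have sq: "4 * lam\<^sup>2 \<ge> 100" using power_mono[OF l5, of 2] by simp
  define L where "L = nat \<lceil>log 2 (4 * lam\<^sup>2)\<rceil>"
  have lg: "log 2 (4 * lam\<^sup>2) \<ge> 0"
  proof -
    have "1 \<le> 4 * lam\<^sup>2" "0 < 4 * lam\<^sup>2" using sq by linarith+
    then show ?thesis by (subst zero_le_log_cancel_iff) auto
  qed
  have "4 * lam\<^sup>2 = 2 powr log 2 (4 * lam\<^sup>2)" using l5 by simp
  also have "\<dots> \<le> 2 powr real L" using lg unfolding L_def by (intro powr_mono) (auto simp: of_nat_nat)
  finally have L1: "4 * lam\<^sup>2 \<le> 2 ^ L" by (simp add: powr_realpow)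
  have L4: "4 \<le> L"
  proof (rule ccontr)
    assume "\<not> 4 \<le> L"
    then have "(2 :: real) ^ L \<le> 2 ^ 3" by (intro power_increasing) auto
    then show False using L1 sq by simp
  qed
  have "3 * m \<le> 2 ^ m" if "4 \<le> m" for m :: nat
    using that by (induction m rule: dec_induct) auto
  then have L3: "3 * L \<le> 2 ^ L" using L4 by simp
  have "real L \<le> log 2 (4 * lam\<^sup>2) + 1" using lg unfolding L_def by linarith
  also have "log 2 (4 * lam\<^sup>2) = 2 + 2 * ln lam / ln 2"
  proof -
    have "log 2 (4 * lam\<^sup>2) = log 2 4 + log 2 (lam\<^sup>2)" using l5 by (intro log_mult_pos) auto
    moreover have "log 2 4 = (2::real)" using log_pow_cancel[of "2::real" 2] by simp
    moreover have "log 2 (lam\<^sup>2) = 2 * ln lam / ln 2" using l5 by (simp add: log_def ln_realpow)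
    ultimately show ?thesis by simp
  qed
  also have "2 * ln lam / ln 2 \<le> 2 * ln lam / (2 / 3)"
    using ln2_ge_two_thirds ln4 by (intro divide_left_mono) auto
  finally have "real L \<le> 4 * ln lam" using ln4 by simp
  with L1 L3 L4 show thesis by (intro that) auto
qed

text \<open>
  The point is \<open>135 * exp 2 < (3 / 2) ^ 20\<close>: a mean depth of \<open>20\<close> beats the growth of the moments with
  an exponential factor to spare, half of which absorbs the constant \<open>270\<close> once \<open>y > 9\<close>.
\<close>

lemma moment_arithmetic:
  fixes y :: real
  assumes Q: "real Q \<le> y + 1" and y: "y > 9"
  shows "2 * 135 ^ Q * (3 / 2) powr (- (20 * y)) < exp (- y)"
proof -
  have "(135 :: real) ^ Q = 135 powr real Q" by (simp add: powr_realpow)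
  also have "\<dots> \<le> 135 powr (y + 1)" using Q by (intro powr_mono) auto
  also have "\<dots> = 135 * exp (y * ln 135)" by (simp add: powr_add) (simp add: powr_def)
  finally have "2 * 135 ^ Q * (3 / 2) powr (- (20 * y))
      \<le> 2 * (135 * exp (y * ln 135)) * (3 / 2) powr (- (20 * y))"
    by (intro mult_right_mono) auto
  also have "\<dots> = 270 * exp (y * (ln 135 - 20 * ln (3 / 2)))"
    by (simp add: powr_def exp_add[symmetric] algebra_simps)
  also have "\<dots> \<le> 270 * exp (y * (- 2))"
  proof -
    have "exp (2::real) = exp 1 * exp 1" by (simp add: exp_add[symmetric])
    also have "\<dots> \<le> 3 * 3" using exp_le by (intro mult_mono) auto
    finally have "exp 2 * 135 \<le> (3 / 2 :: real) ^ 20" by (simp add: power_divide)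
    then have "ln (exp 2 * 135) \<le> ln ((3 / 2 :: real) ^ 20)" by (intro ln_mono) auto
    then have "2 + ln 135 \<le> 20 * ln (3 / 2 :: real)" by (simp add: ln_mult ln_realpow)
    then show ?thesis using y by (intro mult_left_mono iffD2[OF exp_le_cancel_iff]) auto
  qed
  also have "\<dots> < exp y * exp (y * (- 2))"
  proof -
    have "(2 :: real) ^ 9 \<le> exp 1 ^ 9" using exp_ge_add_one_self[of 1] by (intro power_mono) auto
    also have "\<dots> = exp 9" by (simp add: exp_of_nat_mult[symmetric])
    also have "\<dots> < exp y" using y by simp
    finally show ?thesis by simp
  qed
  finally show ?thesis by (simp add: exp_add[symmetric])
qed

theorem lemma4p5:
  fixes f :: "real \<Rightarrow> real" and Cf :: real
  assumes "monotone_with_jump f" and "normalized f"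
    and "angle_constant f Cf"
  shows "\<exists>C>0. \<exists>c>0. \<exists>lam0>0. \<forall>lam>lam0. \<forall>E\<in>{- 2 * lam..2 * lam}. \<forall>\<beta>::real. \<forall>n::nat.
           real n > C * ln lam \<longrightarrow>
           mes_torus (\<lambda>x. \<bar>1 / real n * ln (norm (vvec f lam E \<beta> n x)) - ln lam\<bar> > A_const Cf lam)
             < exp (- (c * real n / ln lam))"
proof -
  have f: "f y = y" if "y \<in> {0..<1}" for y
    using normalized_is_identity assms that by blast
  have Cf: "Cf > 5" using angle_constant_gt_5 f assms(3) by blast
  have "mes_torus (\<lambda>x. \<bar>1 / real n * ln (norm (vvec f lam E \<beta> n x)) - ln lam\<bar> > A_const Cf lam)
             < exp (- (1 / 8 * real n / ln lam))"
    if lam_gt: "lam > exp 4" and E: "E \<in> {- 2 * lam..2 * lam}" and n: "real n > 72 * ln lam"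
    for lam E \<beta> :: real and n :: nat
  proof -
    have l5: "lam \<ge> 5" using exp_ge_add_one_self[of 4] lam_gt by linarith
    have ln0: "ln lam > 0" using l5 by simp
    then have n0: "real n > 0" using n by (smt (verit) mult_nonneg_nonneg)
    interpret doubling_cocycle "E / lam" lam \<beta>
      using E l5 by unfold_locales (auto simp: abs_le_iff divide_le_eq le_divide_eq)
    obtain L where L: "4 * lam\<^sup>2 \<le> 2 ^ L" "3 * L \<le> 2 ^ L" "0 < L" "real L \<le> 4 * ln lam"
      using depth_cutoff_exists[OF less_imp_le[OF lam_gt]] by blast
    define y where "y = real n / real (2 * L)"
    \<comment> \<open>The number of blocks is rounded up so that they cover all times below \<open>n\<close>.\<close>
    define Q where "Q = n div (2 * L) + 1"
    define l where "l = 2 * L * Q + L"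
    have "n < 2 * L * Q" unfolding Q_def using L(3) dividend_less_times_div[of "2 * L" n] by simp
    then have nQ: "n \<le> 2 * L * Q" by simp
    have Qy: "real Q \<le> y + 1"
      unfolding Q_def y_def using of_nat_div_le_of_nat[of n "2 * L", where 'a = real] by simp
    have "9 * real (2 * L) < real n" using n L by simp
    then have y9: "y > 9" unfolding y_def using L(3) by (simp add: less_divide_eq)
    define B where "B = {i \<in> {..<2 ^ l}. 20 * real n < real (total_depth L (2 * L * Q) l i)}"
    \<comment> \<open>Since \<open>3 * Cf > 15 > exp 2\<close>, the term \<open>10 * ln (3 * Cf)\<close> exceeds \<open>20\<close>.\<close>
    have A: "A_const Cf lam > 21" "A_const Cf lam > ln 10 / 2"
    proof -
      have "exp (2::real) = exp 1 * exp 1" by (simp add: exp_add[symmetric])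
      also have "\<dots> \<le> 3 * 3" using exp_le by (intro mult_mono) auto
      finally have "exp 2 < 3 * Cf" using Cf by simp
      then have "2 < ln (3 * Cf)" using ln_strict_mono[of "exp 2" "3 * Cf"] by simp
      then show "A_const Cf lam > 21" by (simp add: A_const_def)
      have "0 \<le> 1 / 4 * Cf * inverse lam" using Cf l5 by simp
      then show "A_const Cf lam > ln 10 / 2" unfolding A_const_def by linarith
    qed
    have "\<exists>i\<in>B. x \<in> dcell l i"
      if x: "x \<in> {0..<1}" and big: "\<bar>1 / real n * ln (norm (vvec f lam E \<beta> n x)) - ln lam\<bar> > A_const Cf lam" for x
    proof -
      let ?v = "ln (norm (vvec f lam E \<beta> n x))"
      have "x \<in> dcell 0 0" using x by (simp add: dcell_def)
      then obtain i where i: "i < 2 ^ l" "x \<in> dcell l i" using dcell_split[of 0 0 l] by auto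
      have up: "?v \<le> real n * (ln lam + ln 10 / 2)"
        using f x refl by (rule ln_norm_vvec_upper)
      have lo: "real n * ln lam - (3 / 2 * real n + real (total_depth L n l i)) * ln 2 \<le> ?v"
        using f x refl i(2) L(1) by (rule ln_norm_vvec_lower) (use nQ in \<open>simp_all add: l_def\<close>)
      \<comment> \<open>The upper deviation never occurs, so the deviation is a loss of more than \<open>21\<close> per step.\<close>
      have "1 / real n * ?v - ln lam \<le> ln 10 / 2" using up n0 by (simp add: field_simps)
      then have "1 / real n * ?v - ln lam < - 21" using big A by linarith
      then have "?v < real n * (ln lam - 21)" using n0 by (simp add: field_simps)
      then have "21 * real n < (3 / 2 * real n + real (total_depth L n l i)) * ln 2"
        using lo by (simp add: algebra_simps)
      also have "\<dots> \<le> (3 / 2 * real n + real (total_depth L n l i)) * (25 / 36)"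
        using ln2_le_25_over_36 by (intro mult_left_mono) auto
      finally have "20 * real n < real (total_depth L n l i)" using n0 by simp
      also have "total_depth L n l i \<le> total_depth L (2 * L * Q) l i"
        unfolding total_depth_def using nQ by (intro sum_mono2) auto
      finally show ?thesis using i by (auto simp: B_def)
    qed
    then have "mes_torus (\<lambda>x. \<bar>1 / real n * ln (norm (vvec f lam E \<beta> n x)) - ln lam\<bar> > A_const Cf lam)
        \<le> real (card B) / 2 ^ l"
      by (rule mes_torus_le_card_dcells) (simp_all add: B_def)
    also have "real (card B) \<le> 2 ^ l * (2 * 135 ^ Q) * (3 / 2) powr (- (20 * real n / real (2 * L)))"
      unfolding B_def using L l_def by (intro card_large_total_depth) auto
    then have "real (card B) / 2 ^ l \<le> 2 * 135 ^ Q * (3 / 2) powr (- (20 * y))"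
      by (simp add: divide_le_eq y_def mult_ac)
    also have "\<dots> < exp (- y)" using Qy y9 by (rule moment_arithmetic)
    also have "exp (- y) \<le> exp (- (1 / 8 * real n / ln lam))"
    proof -
      have "real n / (8 * ln lam) \<le> y"
        unfolding y_def using L n0 ln0 by (intro divide_left_mono) auto
      then show ?thesis by simp
    qed
    finally show ?thesis .
  qed
  then show ?thesis
    by (intro exI[of _ 72] exI[of _ "1 / 8"] exI[of _ "exp 4"] conjI allI ballI impI) auto
qed

end
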